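(* The group action $(T_h)_{h\in H}$ is transitive on $\mathcal{P}_\mu^{\mathrm{ex}}$; that is, for any $\mathbb{P}',\mathbb{P}''\in\mathcal{P}_\mu^{\mathrm{ex}}$ there exists $h\in H$ such that $\mathbb{P}'=T_h(\mathbb{P}'')$.
   Context: $\mathbb{N}=\{1,2,\dots\}$. Let $(G_k)_{k\in\mathbb{N}}$ be a sequence of compact Hausdorff groups with countable bases, let $\phi_k:G_{k+1}\to G_k$ be a continuous homomorphism for each $k$, and let $G:=\prod_{k\in\mathbb{N}}G_k$ with the product topology. Let $\mu=(\mu_k)_{k\in\mathbb{N}}$, where $\mu_k$ is a Borel probability measure on $G_k$. Let $H:=\{(g_k)_{k\in\mathbb{N}}\in G: g_k=\phi_k(g_{k+1})\ \text{for all } k\in\mathbb{N}\}$, a compact subgroup of $G$. Let $X_k:G\to G_k$ be the $k$-th coordinate map and $Z_k:=\phi_k(X_{k+1})^{-1}X_k$. The set $\mathcal{P}_\mu$ of solutions of the stochastic equation associated with $\mu$ is the set of Borel probability measures $\mathbb{P}$ on $G$ such that for every $k\in\mathbb{N}$ and every bounded Borel $f:G_k\to\mathbb{R}$, the conditional expectation of $f(X_k)$ given $(X_j)_{j>k}$ under $\mathbb{P}$ equals $\int_{G_k}f(\phi_k(X_{k+1})z)\,\mu_k(dz)$ $\mathbb{P}$-a.s.; equivalently, for every $k$, under $\mathbb{P}$ the variable $Z_k$ has distribution $\mu_k$ and is independent of $(X_j)_{j>k}$. The set $\mathcal{P}_\mu$ is convex (and compact for weak convergence), and $\mathcal{P}_\mu^{\mathrm{ex}}$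 denotes its set of extreme points. For $h=(h_k)_{k\in\mathbb{N}}\in H$ and $\mathbb{P}\in\mathcal{P}_\mu$, $T_h(\mathbb{P})$ is the distribution of $(h_kX_k)_{k\in\mathbb{N}}$ under $\mathbb{P}$. This defines a group action of $H$ on $\mathcal{P}_\mu$ that leaves $\mathcal{P}_\mu^{\mathrm{ex}}$ invariant. *)

theory Defs
  imports "HOL-Probability.Probability" "HOL-Algebra.Group"
begin

(* The type classes for topological groups are additive and have the whole type as carrier, so
   groups are HOL-Algebra records together with an abstract topology on the carrier. *)

locale topological_group = group G for G (structure) +
  fixes T :: "'a topology"
  assumes topspace_eq_carrier: "topspace T = carrier G"
    and continuous_map_mult: "continuous_map (prod_topology T T) T (\<lambda>(x, y). x \<otimes> y)"
    and continuous_map_inv: "continuous_map T T (\<lambda>x. inv x)"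

locale compact_second_countable_group = topological_group +
  assumes compact_space: "compact_space T"
    and Hausdorff_space: "Hausdorff_space T"
    and second_countable: "second_countable T"

(* The library's borel refers to a type-class topology only. *)
definition borel_of :: "'a topology \<Rightarrow> 'a measure" where
  "borel_of X = sigma (topspace X) {U. openin X U}"

lemma space_borel_of: "space (borel_of X) = topspace X"
  by (simp add: borel_of_def space_measure_of_conv)

lemma sets_borel_of: "sets (borel_of X) = sigma_sets (topspace X) {U. openin X U}"
  unfolding borel_of_def by (rule sets_measure_of) (auto dest: openin_subset)

lemma continuous_map_measurable:
  assumes "continuous_map X Y f"
  shows "f \<in> borel_of X \<rightarrow>\<^sub>M borel_of Y"
proof -
  have "f \<in> borel_of X \<rightarrow>\<^sub>M sigma (topspace Y) {U. openin Y U}"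
  proof (rule measurable_measure_of)
    show "{U. openin Y U} \<subseteq> Pow (topspace Y)"
      by (auto dest: openin_subset)
    show "f \<in> space (borel_of X) \<rightarrow> topspace Y"
      using assms by (auto simp: space_borel_of continuous_map_def)
    show "f -` U \<inter> space (borel_of X) \<in> sets (borel_of X)" if "U \<in> {U. openin Y U}" for U
    proof -
      have "f -` U \<inter> space (borel_of X) = {x \<in> topspace X. f x \<in> U}"
        by (auto simp: space_borel_of)
      moreover have "openin X {x \<in> topspace X. f x \<in> U}"
        using assms that by (auto simp: continuous_map_def)
      ultimately show ?thesis
        by (simp add: sets_borel_of sigma_sets.Basic)
    qed
  qed
  then show ?thesis
    by (simp add: borel_of_def)
qed

definition borel_prob :: "'a topology \<Rightarrow> 'a measure set" where
  "borel_prob X = {M. sets M = sets (borel_of X) \<and> prob_space M}"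

(* The k-th coordinate map X_k is \<lambda>x. x k. Points of the product lie in the
   extensional product over UNIV, which is the set of all sequences x with x k in topspace (T k). *)
abbreviation seq_topology :: "(nat \<Rightarrow> 'a topology) \<Rightarrow> (nat \<Rightarrow> 'a) topology" where
  "seq_topology T \<equiv> product_topology T UNIV"

(* The sigma-algebra generated by the coordinates X_j with j > k. *)
definition future_algebra :: "(nat \<Rightarrow> 'a topology) \<Rightarrow> nat \<Rightarrow> (nat \<Rightarrow> 'a) measure" where
  "future_algebra T k =
     vimage_algebra (topspace (seq_topology T)) (\<lambda>x. \<lambda>j\<in>{k<..}. x j)
       (\<Pi>\<^sub>M j\<in>{k<..}. borel_of (T j))"

(* real_cond_exp is the constant 0 when its second argument is not a subalgebra of the first. *)
lemma subalgebra_future_algebra: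
  assumes "P \<in> borel_prob (seq_topology T)"
  shows "subalgebra P (future_algebra T k)"
proof -
  have sets_P: "sets P = sets (borel_of (seq_topology T))"
    using assms by (simp add: borel_prob_def)
  then have space_P: "space P = topspace (seq_topology T)"
    using sets_eq_imp_space_eq space_borel_of by metis
  have "(\<lambda>x. x j) \<in> borel_of (seq_topology T) \<rightarrow>\<^sub>M borel_of (T j)" for j
    by (intro continuous_map_measurable continuous_map_product_projection) simp
  then have "(\<lambda>x. \<lambda>j\<in>{k<..}. x j) \<in> borel_of (seq_topology T) \<rightarrow>\<^sub>M (\<Pi>\<^sub>M j\<in>{k<..}. borel_of (T j))"
    by (intro measurable_restrict)
  then have meas: "(\<lambda>x. \<lambda>j\<in>{k<..}. x j) \<in> P \<rightarrow>\<^sub>M (\<Pi>\<^sub>M j\<in>{k<..}. borel_of (T j))"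
    by (subst measurable_cong_sets[OF sets_P refl])
  show ?thesis
    using measurable_sets[OF meas] measurable_space[OF meas] unfolding subalgebra_def
    by (auto simp: future_algebra_def space_P sets_vimage_algebra2 Pi_iff)
qed

definition solutions ::
    "(nat \<Rightarrow> ('a, 'b) monoid_scheme) \<Rightarrow> (nat \<Rightarrow> 'a topology) \<Rightarrow> (nat \<Rightarrow> 'a \<Rightarrow> 'a) \<Rightarrow>
     (nat \<Rightarrow> 'a measure) \<Rightarrow> (nat \<Rightarrow> 'a) measure set" where
  "solutions G T \<phi> \<mu> =
     {P \<in> borel_prob (seq_topology T).
        \<forall>k. \<forall>f \<in> borel_measurable (borel_of (T k)). (\<exists>B. \<forall>y \<in> carrier (G k). \<bar>f y\<bar> \<le> B) \<longrightarrow>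
          (AE x in P. real_cond_exp P (future_algebra T k) (\<lambda>x. f (x k)) x =
             (\<integral>z. f (\<phi> k (x (Suc k)) \<otimes>\<^bsub>G k\<^esub> z) \<partial>\<mu> k))}"

(* The library's extreme_point_of needs a real vector space, which the type of measures is not;
   this is the same notion for probability measures on a common sigma-algebra, with the convex
   combination t * Q1 + (1 - t) * Q2 written out setwise. *)
definition extreme_measures :: "'a measure set \<Rightarrow> 'a measure set" where
  "extreme_measures S =
     {P \<in> S. \<forall>Q1 \<in> S. \<forall>Q2 \<in> S. \<forall>t \<in> {0<..<1}.
        (\<forall>A \<in> sets P. measure P A = t * measure Q1 A + (1 - t) * measure Q2 A) \<longrightarrow> Q1 = Q2}"

definition compatible_seqs ::
    "(nat \<Rightarrow> ('a, 'b) monoid_scheme) \<Rightarrow> (nat \<Rightarrow> 'a \<Rightarrow> 'a) \<Rightarrow> (nat \<Rightarrow> 'a) set" where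
  "compatible_seqs G \<phi> =
     {g. (\<forall>k. g k \<in> carrier (G k)) \<and> (\<forall>k. g k = \<phi> k (g (Suc k)))}"

definition translate ::
    "(nat \<Rightarrow> ('a, 'b) monoid_scheme) \<Rightarrow> (nat \<Rightarrow> 'a topology) \<Rightarrow> (nat \<Rightarrow> 'a) \<Rightarrow>
     (nat \<Rightarrow> 'a) measure \<Rightarrow> (nat \<Rightarrow> 'a) measure" where
  "translate G T h P = distr P (borel_of (seq_topology T)) (\<lambda>x k. h k \<otimes>\<^bsub>G k\<^esub> x k)"

end

theory Submission
  imports Defs
begin

text \<open>For a solution \<open>P\<close>, the conditional expectation of a bounded function \<open>f\<close> of the whole sequence
  given the coordinates from \<open>n\<close> on has an explicit version: integrate out the coordinates
  \<open>0, \<dots>, n - 1\<close> one after the other, redrawing each one from its successor and fresh noise.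
  The resulting operator \<open>average n\<close> is the same for all solutions, and two facts about it give the
  theorem.

  First, if \<open>P\<close> is extreme then \<open>average n f\<close> tends to the constant \<open>\<integral>f dP\<close> in mean square
  (\<open>extreme_average_variance_tendsto_0\<close>). The functions \<open>average n f\<close> form a reverse martingale and
  so have a limit \<open>g\<close>, which depends on the tail of the sequence only. If \<open>g\<close> were not constant, the
  densities \<open>1 \<plusminus> c (g - \<integral>g dP)\<close> would turn \<open>P\<close> into two different solutions with midpoint \<open>P\<close>. Hence,
  for \<open>n\<close> large and finitely many \<open>f\<close>, there is a single point \<open>x\<close> at which all the numbers
  \<open>average n f x\<close> are close to the integrals \<open>\<integral>f dP\<close> (\<open>extreme_eventually_average_close\<close>).

  Second, the noise enters on the right, so averaging commutes with the left translation by any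
  sequence \<open>h\<close> that satisfies \<open>h k = \<phi> k (h (Suc k))\<close> for \<open>k < n\<close> (\<open>average_act\<close>). Let \<open>x'\<close> and
  \<open>x''\<close> be good points for \<open>P'\<close> and \<open>P''\<close>. Put \<open>h k = x' k (x'' k)\<^sup>-\<^sup>1\<close> for \<open>k \<ge> n\<close>, and extend \<open>h\<close>
  below \<open>n\<close> by the maps \<open>\<phi> k\<close>. Then \<open>h x''\<close> and \<open>x'\<close> agree from \<open>n\<close> on, so that \<open>average n\<close>
  takes the same value for \<open>f\<close> at \<open>x'\<close> and for \<open>f (h \<cdot>)\<close> at \<open>x''\<close>: the integrals of \<open>f\<close> under
  \<open>P'\<close> and of \<open>f (h \<cdot>)\<close> under \<open>P''\<close> almost coincide (\<open>ex_approximate_translation\<close>). The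
  point \<open>x''\<close> has to be chosen before \<open>h\<close>; this is harmless for continuous \<open>f\<close>, whose translates are
  totally bounded in the supremum norm.

  Finally, compatibility of \<open>h\<close> at every index and closeness of the two integrals for every
  continuous \<open>f\<close> are closed conditions on \<open>h\<close> with the finite intersection property. By compactness
  some \<open>h\<close> satisfies all of them (\<open>ex_translation\<close>), and continuous functions determine a
  Borel measure (\<open>borel_prob_eqI_continuous\<close>).\<close>

section \<open>Two facts on integrals\<close>

lemma (in prob_space) integral_close:
  fixes f g :: "'a \<Rightarrow> real"
  assumes int: "integrable M f" "integrable M g"
    and close: "\<And>x. x \<in> space M \<Longrightarrow> \<bar>f x - g x\<bar> \<le> \<epsilon>"
  shows "\<bar>(\<integral>x. f x \<partial>M) - (\<integral>x. g x \<partial>M)\<bar> \<le> \<epsilon>"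
proof -
  have "f x - g x \<le> \<epsilon>" "- \<epsilon> \<le> f x - g x" if "x \<in> space M" for x
    using close[OF that] by linarith+
  then have "AE x in M. f x - g x \<le> \<epsilon>" "AE x in M. - \<epsilon> \<le> f x - g x"
    by auto
  then have "(\<integral>x. f x - g x \<partial>M) \<le> \<epsilon>" "- \<epsilon> \<le> (\<integral>x. f x - g x \<partial>M)"
    using int by (simp_all only: integral_le_const integral_ge_const Bochner_Integration.integrable_diff)
  then show ?thesis
    using int by simp
qed

text \<open>The total variation of the path \<open>j \<mapsto> u j x\<close> has finite integral, so almost every path has
  finite variation and hence a limit. This is the argument behind the completeness of \<open>L\<^sup>1\<close>.\<close>

lemma AE_convergent_if_summable_increments:
  fixes u :: "nat \<Rightarrow> 'a \<Rightarrow> real"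
  assumes u: "\<And>j. integrable M (u j)"
    and summable: "summable (\<lambda>j. \<integral>x. \<bar>u (Suc j) x - u j x\<bar> \<partial>M)"
  shows "AE x in M. convergent (\<lambda>j. u j x)"
proof -
  note [measurable] = borel_measurable_integrable[OF u]
  have "AE x in M. (\<Sum>j. ennreal \<bar>u (Suc j) x - u j x\<bar>) \<noteq> \<infinity>"
  proof (rule nn_integral_PInf_AE)
    have "(\<integral>\<^sup>+x. (\<Sum>j. ennreal \<bar>u (Suc j) x - u j x\<bar>) \<partial>M) =
        (\<Sum>j. \<integral>\<^sup>+x. ennreal \<bar>u (Suc j) x - u j x\<bar> \<partial>M)"
      by (intro nn_integral_suminf) measurable
    also have "\<dots> = (\<Sum>j. ennreal (\<integral>x. \<bar>u (Suc j) x - u j x\<bar> \<partial>M))"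
      using u by (subst nn_integral_eq_integral) auto
    also have "\<dots> = ennreal (\<Sum>j. \<integral>x. \<bar>u (Suc j) x - u j x\<bar> \<partial>M)"
      by (intro suminf_ennreal_eq summable_sums summable) simp
    finally show "(\<integral>\<^sup>+x. (\<Sum>j. ennreal \<bar>u (Suc j) x - u j x\<bar>) \<partial>M) \<noteq> \<infinity>" by simp
  qed measurable
  then show ?thesis
  proof eventually_elim
    case (elim x)
    then have "summable (\<lambda>j. \<bar>u (Suc j) x - u j x\<bar>)"
      by (intro summable_suminf_not_top) auto
    then have "summable (\<lambda>j. u (Suc j) x - u j x)"
      by (rule summable_rabs_cancel)
    then have "convergent (\<lambda>n. \<Sum>j<n. u (Suc j) x - u j x)"
      by (simp add: summable_iff_convergent)
    then have "convergent (\<lambda>n. u n x - u 0 x)"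
      by (simp only: sum_lessThan_telescope[of "\<lambda>j. u j x"])
    from convergent_add[OF this convergent_const[of "u 0 x"]] show "convergent (\<lambda>n. u n x)"
      by simp
  qed
qed

section \<open>Borel sets of second countable spaces\<close>

text \<open>Every open set is a countable union of members of the base, so a
  \<open>\<sigma>\<close>-algebra that contains the base contains all Borel sets.\<close>

lemma sets_borel_of_second_countable_subset:
  assumes "countable \<B>" and base: "\<And>U x. openin X U \<Longrightarrow> x \<in> U \<Longrightarrow> \<exists>V\<in>\<B>. x \<in> V \<and> V \<subseteq> U"
    and meas: "\<B> \<subseteq> sets M" and space: "space M = topspace X"
  shows "sets (borel_of X) \<subseteq> sets M"
proof -
  have "U \<in> sets M" if "openin X U" for U
  proof -
    have "U = \<Union>{V\<in>\<B>. V \<subseteq> U}"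
      using base[OF that] by blast
    also have "\<dots> \<in> sets M"
      using meas by (intro sets.countable_Union countable_subset[OF _ \<open>countable \<B>\<close>]) auto
    finally show ?thesis .
  qed
  then show ?thesis
    unfolding sets_borel_of space[symmetric] by (intro sets.sigma_sets_subset) auto
qed

lemma second_countableE:
  assumes "second_countable X"
  obtains \<B> where "countable \<B>" "\<And>V. V \<in> \<B> \<Longrightarrow> openin X V"
    "\<And>U x. openin X U \<Longrightarrow> x \<in> U \<Longrightarrow> \<exists>V\<in>\<B>. x \<in> V \<and> V \<subseteq> U"
proof -
  obtain \<B> where \<B>: "countable \<B> \<and> (\<forall>V\<in>\<B>. openin X V) \<and>
      (\<forall>U x. openin X U \<and> x \<in> U \<longrightarrow> (\<exists>V\<in>\<B>. x \<in> V \<and> V \<subseteq> U))"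
    using assms unfolding second_countable_def by (rule exE)
  show ?thesis
    by (rule that[of \<B>]) (simp_all add: \<B>)
qed

lemma continuous_map_borel_measurable:
  assumes "continuous_map X euclidean f"
  shows "f \<in> borel_measurable (borel_of X)"
  using continuous_map_measurable[OF assms] by (simp add: borel_of_def borel_def)

lemma openin_imp_sets_borel_of: "openin X U \<Longrightarrow> U \<in> sets (borel_of X)"
  by (simp add: sets_borel_of sigma_sets.Basic)

lemma closedin_imp_sets_borel_of: "closedin X C \<Longrightarrow> C \<in> sets (borel_of X)"
  using sets.compl_sets[OF openin_imp_sets_borel_of[of X "topspace X - C"]] closedin_subset[of X C]
  by (auto simp: space_borel_of double_diff closedin_def)

lemma prod_topology_second_countable_base:
  assumes "second_countable X" "second_countable Y"
  obtains \<B> where "countable \<B>"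
    "\<And>U x. openin (prod_topology X Y) U \<Longrightarrow> x \<in> U \<Longrightarrow> \<exists>V\<in>\<B>. x \<in> V \<and> V \<subseteq> U"
    "\<B> \<subseteq> sets (borel_of X \<Otimes>\<^sub>M borel_of Y)"
proof -
  obtain A where A: "countable A" "\<And>V. V \<in> A \<Longrightarrow> openin X V"
      "\<And>U x. openin X U \<Longrightarrow> x \<in> U \<Longrightarrow> \<exists>V\<in>A. x \<in> V \<and> V \<subseteq> U"
    by (rule second_countableE[OF assms(1)], rule that)
  obtain B where B: "countable B" "\<And>V. V \<in> B \<Longrightarrow> openin Y V"
      "\<And>U x. openin Y U \<Longrightarrow> x \<in> U \<Longrightarrow> \<exists>V\<in>B. x \<in> V \<and> V \<subseteq> U"
    by (rule second_countableE[OF assms(2)], rule that)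
  show ?thesis
  proof
    show "countable ((\<lambda>(V, W). V \<times> W) ` (A \<times> B))"
      using A(1) B(1) by auto
    show "(\<lambda>(V, W). V \<times> W) ` (A \<times> B) \<subseteq> sets (borel_of X \<Otimes>\<^sub>M borel_of Y)"
      using A(2) B(2) by (auto intro!: openin_imp_sets_borel_of)
    fix U x assume U: "openin (prod_topology X Y) U" and x: "x \<in> U"
    obtain V W where "openin X V" "openin Y W" "fst x \<in> V" "snd x \<in> W" "V \<times> W \<subseteq> U"
      using U x unfolding openin_prod_topology_alt by (metis prod.collapse)
    moreover from this obtain V' W' where "V' \<in> A" "W' \<in> B" "fst x \<in> V'" "snd x \<in> W'" "V' \<subseteq> V" "W' \<subseteq> W"
      using A(3) B(3) by meson
    ultimately show "\<exists>V\<in>(\<lambda>(V, W). V \<times> W) ` (A \<times> B). x \<in> V \<and> V \<subseteq> U"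
      by (intro bexI[of _ "V' \<times> W'"]) (auto simp: mem_Times_iff)
  qed
qed

lemma sets_borel_of_prod_topology:
  assumes "second_countable X" "second_countable Y"
  shows "sets (borel_of (prod_topology X Y)) \<subseteq> sets (borel_of X \<Otimes>\<^sub>M borel_of Y)"
  by (rule prod_topology_second_countable_base[OF assms],
      rule sets_borel_of_second_countable_subset)
    (auto simp: space_borel_of space_pair_measure)

lemma seq_topology_second_countable_base:
  fixes T :: "nat \<Rightarrow> 'a topology"
  assumes "\<And>k. second_countable (T k)"
  obtains \<B> where "countable \<B>" "\<And>V. V \<in> \<B> \<Longrightarrow> openin (seq_topology T) V"
    "\<And>U x. openin (seq_topology T) U \<Longrightarrow> x \<in> U \<Longrightarrow> \<exists>V\<in>\<B>. x \<in> V \<and> V \<subseteq> U"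
    "\<B> \<subseteq> sets (\<Pi>\<^sub>M k\<in>UNIV. borel_of (T k))"
proof -
  have "\<exists>A. countable A \<and> (\<forall>V\<in>A. openin (T k) V) \<and>
      (\<forall>U x. openin (T k) U \<and> x \<in> U \<longrightarrow> (\<exists>V\<in>A. x \<in> V \<and> V \<subseteq> U))" for k
    using assms[of k] unfolding second_countable_def .
  then obtain A where A: "\<And>k. countable (A k)" "\<And>k V. V \<in> A k \<Longrightarrow> openin (T k) V"
      "\<And>k U x. openin (T k) U \<Longrightarrow> x \<in> U \<Longrightarrow> \<exists>V\<in>A k. x \<in> V \<and> V \<subseteq> U"
    by metis
  \<comment> \<open>The whole factor must be available as a side of a box, but it need not belong to a base.\<close>
  define A' where "A' k = insert (topspace (T k)) (A k)" for k
  define \<B> where "\<B> = PiE UNIV ` {X. (\<forall>k. X k \<in> A' k) \<and> finite {k. X k \<noteq> topspace (T k)}}"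
  have op: "openin (T k) (X k)" if "\<forall>k. X k \<in> A' k" for X k
  proof -
    have "X k \<in> A' k" using that by blast
    then show ?thesis using A(2)[of "X k" k] by (auto simp: A'_def)
  qed
  show ?thesis
  proof
    \<comment> \<open>The sides that are whole factors vary with \<open>k\<close>. Coding them all by \<open>None\<close> turns the boxes into
      sequences that are eventually constant.\<close>
    have "{X. (\<forall>k. X k \<in> A' k) \<and> finite {k. X k \<noteq> topspace (T k)}} \<subseteq>
        (\<lambda>Y k. case Y k of None \<Rightarrow> topspace (T k) | Some V \<Rightarrow> V) `
          {Y. (\<forall>k. Y k \<in> insert None (Some ` A' k)) \<and> finite {k. Y k \<noteq> None}}"
    proof
      fix X assume "X \<in> {X. (\<forall>k. X k \<in> A' k) \<and> finite {k. X k \<noteq> topspace (T k)}}"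
      then show "X \<in> (\<lambda>Y k. case Y k of None \<Rightarrow> topspace (T k) | Some V \<Rightarrow> V) `
          {Y. (\<forall>k. Y k \<in> insert None (Some ` A' k)) \<and> finite {k. Y k \<noteq> None}}"
        by (intro image_eqI[of _ _ "\<lambda>k. if X k = topspace (T k) then None else Some (X k)"])
          (auto simp: fun_eq_iff)
    qed
    moreover have "countable {Y. (\<forall>k. Y k \<in> insert None (Some ` A' k)) \<and> finite {k. Y k \<noteq> None}}"
      by (intro countable_product_event_const) (auto simp: A'_def A(1))
    ultimately show "countable \<B>"
      unfolding \<B>_def by (intro countable_image) (meson countable_image countable_subset)
    show "openin (seq_topology T) V" if "V \<in> \<B>" for V
      using that unfolding \<B>_def by (auto intro!: product_topology_basis op)
    show "\<B> \<subseteq> sets (\<Pi>\<^sub>M k\<in>UNIV. borel_of (T k))"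
      unfolding \<B>_def by (auto intro!: sets_PiM_I_countable openin_imp_sets_borel_of op)
    fix U x assume "openin (seq_topology T) U" "x \<in> U"
    then have "\<exists>X. x \<in> PiE UNIV X \<and> (\<forall>i. openin (T i) (X i)) \<and>
        finite {i. X i \<noteq> topspace (T i)} \<and> PiE UNIV X \<subseteq> U"
      by (rule product_topology_open_contains_basis)
    then obtain X where X: "x \<in> PiE UNIV X" "\<And>i. openin (T i) (X i)"
        "finite {i. X i \<noteq> topspace (T i)}" "PiE UNIV X \<subseteq> U"
      by auto
    have "\<exists>V\<in>A' k. x k \<in> V \<and> V \<subseteq> X k \<and> (X k = topspace (T k) \<longrightarrow> V = topspace (T k))" for k
    proof (cases "X k = topspace (T k)")
      case True
      then show ?thesis using PiE_mem[OF X(1), of k] by (auto simp: A'_def)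
    next
      case False
      then show ?thesis using A(3)[OF X(2) PiE_mem[OF X(1) UNIV_I]] by (auto simp: A'_def)
    qed
    then obtain V where V: "\<And>k. V k \<in> A' k" "\<And>k. x k \<in> V k" "\<And>k. V k \<subseteq> X k"
        "\<And>k. X k = topspace (T k) \<Longrightarrow> V k = topspace (T k)"
      by metis
    have "finite {k. V k \<noteq> topspace (T k)}"
      by (rule finite_subset[OF _ X(3)]) (use V(4) in auto)
    then show "\<exists>V\<in>\<B>. x \<in> V \<and> V \<subseteq> U"
      unfolding \<B>_def using V X(4)
      by (intro bexI[of _ "PiE UNIV V"]) (auto simp: PiE_iff subset_iff)
  qed
qed

lemma sets_borel_of_seq_topology:
  fixes T :: "nat \<Rightarrow> 'a topology"
  assumes "\<And>k. second_countable (T k)"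
  shows "sets (borel_of (seq_topology T)) = sets (\<Pi>\<^sub>M k\<in>UNIV. borel_of (T k))"
proof
  show "sets (borel_of (seq_topology T)) \<subseteq> sets (\<Pi>\<^sub>M k\<in>UNIV. borel_of (T k))"
  proof -
    obtain \<B> where "countable \<B>"
        "\<And>U x. openin (seq_topology T) U \<Longrightarrow> x \<in> U \<Longrightarrow> \<exists>V\<in>\<B>. x \<in> V \<and> V \<subseteq> U"
        "\<B> \<subseteq> sets (\<Pi>\<^sub>M k\<in>UNIV. borel_of (T k))"
      by (rule seq_topology_second_countable_base[of T]) (use assms in auto)
    then show ?thesis
      by (rule sets_borel_of_second_countable_subset) (auto simp: space_borel_of space_PiM)
  qed
  have "(\<lambda>x. \<lambda>k\<in>UNIV. x k) \<in> borel_of (seq_topology T) \<rightarrow>\<^sub>M (\<Pi>\<^sub>M k\<in>UNIV. borel_of (T k))"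
    by (intro measurable_restrict continuous_map_measurable continuous_map_product_projection) simp
  moreover have "(\<lambda>x :: nat \<Rightarrow> 'a. \<lambda>k\<in>UNIV. x k) = (\<lambda>x. x)"
    by (simp add: fun_eq_iff)
  ultimately have *: "(\<lambda>x. x) \<in> borel_of (seq_topology T) \<rightarrow>\<^sub>M (\<Pi>\<^sub>M k\<in>UNIV. borel_of (T k))"
    by simp
  show "sets (\<Pi>\<^sub>M k\<in>UNIV. borel_of (T k)) \<subseteq> sets (borel_of (seq_topology T))"
    using measurable_sets[OF *] sets.sets_into_space
    by (fastforce simp: space_borel_of space_PiM Int_absorb2)
qed

lemma second_countable_seq_topology:
  fixes T :: "nat \<Rightarrow> 'a topology"
  assumes "\<And>k. second_countable (T k)"
  shows "second_countable (seq_topology T)"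
proof -
  obtain \<B> where "countable \<B>" "\<And>V. V \<in> \<B> \<Longrightarrow> openin (seq_topology T) V"
      "\<And>U x. openin (seq_topology T) U \<Longrightarrow> x \<in> U \<Longrightarrow> \<exists>V\<in>\<B>. x \<in> V \<and> V \<subseteq> U"
    by (rule seq_topology_second_countable_base[of T]) (use assms in auto)
  then show ?thesis
    unfolding second_countable_def by (intro exI[of _ \<B>]) auto
qed

text \<open>An open set \<open>U\<close> is a countable union of closed sets \<open>K\<close>. A Urysohn
  function that is 1 on \<open>K\<close> and 0 off \<open>U\<close> lies between the two indicators, so the measure of \<open>K\<close>
  under \<open>P\<close> is at most that of \<open>U\<close> under \<open>Q\<close>, and exhausting \<open>U\<close> gives the same for \<open>U\<close>
  in place of \<open>K\<close>. By symmetry the two measures agree on open sets.\<close>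

lemma borel_prob_eqI_continuous:
  assumes X: "compact_space X" "Hausdorff_space X" "second_countable X"
    and P: "P \<in> borel_prob X" and Q: "Q \<in> borel_prob X"
    and eq: "\<And>f. continuous_map X euclideanreal f \<Longrightarrow> (\<integral>x. f x \<partial>P) = (\<integral>x. f x \<partial>Q)"
  shows "P = Q"
proof -
  have le: "measure P U \<le> measure Q U"
    if P: "P \<in> borel_prob X" and Q: "Q \<in> borel_prob X" and U: "openin X U"
      and eq: "\<And>f. continuous_map X euclideanreal f \<Longrightarrow> (\<integral>x. f x \<partial>P) = (\<integral>x. f x \<partial>Q)" for P Q U
  proof -
    interpret P: prob_space P using P by (simp add: borel_prob_def)
    interpret Q: prob_space Q using Q by (simp add: borel_prob_def)
    have sets: "sets P = sets (borel_of X)" "sets Q = sets (borel_of X)"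
      using P Q by (auto simp: borel_prob_def)
    have space: "space P = topspace X" "space Q = topspace X"
      using sets[THEN sets_eq_imp_space_eq] by (simp_all add: space_borel_of)
    obtain \<B> where \<B>: "countable \<B>" "\<And>V. V \<in> \<B> \<Longrightarrow> openin X V"
        "\<And>U x. openin X U \<Longrightarrow> x \<in> U \<Longrightarrow> \<exists>V\<in>\<B>. x \<in> V \<and> V \<subseteq> U"
      by (rule second_countableE[OF X(3)], rule that)
    define \<C> where "\<C> = insert {} ((closure_of) X ` {V \<in> \<B>. X closure_of V \<subseteq> U})"
    have "countable \<C>"
      unfolding \<C>_def using \<B>(1) by (auto intro: countable_subset)
    then have "range (from_nat_into \<C>) = \<C>"
      by (intro range_from_nat_into) (simp_all add: \<C>_def)
    then obtain C :: "nat \<Rightarrow> _" where C: "\<C> = range C"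
      by (rule that[OF sym])
    have closed: "closedin X (C i)" "C i \<subseteq> U" for i
    proof -
      have "C i \<in> \<C>" by (simp add: C)
      then show "closedin X (C i)" "C i \<subseteq> U" unfolding \<C>_def by auto
    qed
    have "regular_space X" "normal_space X"
      using X by (simp_all add: compact_Hausdorff_imp_regular_space compact_Hausdorff_or_regular_imp_normal_space)
    have "U \<subseteq> \<Union>\<C>"
    proof
      fix x assume "x \<in> U"
      then have "\<exists>V. openin X V \<and> (\<exists>K. closedin X K \<and> x \<in> V \<and> V \<subseteq> K \<and> K \<subseteq> U)"
        using iffD2[OF neighbourhood_base_of_closedin \<open>regular_space X\<close>] U
        by (simp add: neighbourhood_base_of)
      then obtain V K where V: "openin X V" "closedin X K" "x \<in> V" "V \<subseteq> K" "K \<subseteq> U"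
        by auto
      then obtain W where W: "W \<in> \<B>" "x \<in> W" "W \<subseteq> V"
        using \<B>(3)[of V x] by auto
      have "(X closure_of W) \<subseteq> U"
        using V W by (meson closure_of_minimal subset_trans)
      moreover have "x \<in> (X closure_of W)"
        using W \<B>(2) by (meson closure_of_subset openin_subset subsetD)
      ultimately show "x \<in> \<Union>\<C>"
        using W unfolding \<C>_def by auto
    qed
    moreover have "\<Union>\<C> = (\<Union>n. \<Union>i\<le>n. C i)"
      unfolding C by auto
    ultimately have U_eq: "U = (\<Union>n. \<Union>i\<le>n. C i)"
      using UN_least[of UNIV C U, OF closed(2)] C by auto
    have bound: "measure P (\<Union>i\<le>n. C i) \<le> measure Q U" for n
    proof -
      define K where "K = (\<Union>i\<le>n. C i)"
      have K: "closedin X K" "K \<subseteq> U"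
        unfolding K_def using closed by (auto intro!: closedin_Union)
      have D: "disjnt (topspace X - U) K" "closedin X (topspace X - U)"
        using K U by (auto simp: disjnt_def)
      obtain f where f: "continuous_map X (top_of_set {0..1::real}) f"
          "f ` (topspace X - U) \<subseteq> {0}" "f ` K \<subseteq> {1}"
        by (rule Urysohn_lemma[OF \<open>normal_space X\<close> D(2) K(1) D(1) zero_le_one], rule that)
      have f': "continuous_map X euclideanreal f" "\<And>x. x \<in> topspace X \<Longrightarrow> 0 \<le> f x \<and> f x \<le> 1"
        using f(1) unfolding continuous_map_in_subtopology by auto
      have fm: "f \<in> borel_measurable (borel_of X)"
        by (rule continuous_map_borel_measurable[OF f'(1)])
      have [measurable]: "K \<in> sets P" "U \<in> sets Q" "f \<in> borel_measurable P" "f \<in> borel_measurable Q"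
        using K U fm by (simp_all add: sets closedin_imp_sets_borel_of openin_imp_sets_borel_of cong: measurable_cong_sets)
      have "measure P K = (\<integral>x. indicator K x \<partial>P)"
        by simp
      also have "\<dots> \<le> (\<integral>x. f x \<partial>P)"
      proof (rule integral_mono)
        show "integrable P f"
          using f'(2) by (intro P.integrable_const_bound[where B=1] AE_I2) (auto simp: space)
        show "indicator K x \<le> f x" if "x \<in> space P" for x
          using f(3) f'(2) that by (auto simp: indicator_def space)
      qed (auto simp: integrable_real_indicator P.emeasure_eq_measure Q.emeasure_eq_measure)
      also have "\<dots> = (\<integral>x. f x \<partial>Q)"
        by (rule eq[OF f'(1)])
      also have "\<dots> \<le> (\<integral>x. indicator U x \<partial>Q)"
      proof (rule integral_mono)
        show "integrable Q f"
          using f'(2) by (intro Q.integrable_const_bound[where B=1] AE_I2) (auto simp: space)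
        show "f x \<le> indicator U x" if "x \<in> space Q" for x
          using f(2) f'(2) that by (auto simp: indicator_def space)
      qed (auto simp: integrable_real_indicator P.emeasure_eq_measure Q.emeasure_eq_measure)
      also have "\<dots> = measure Q U"
        by simp
      finally show ?thesis unfolding K_def .
    qed
    have "(\<lambda>n. measure P (\<Union>i\<le>n. C i)) \<longlonglongrightarrow> measure P (\<Union>n. \<Union>i\<le>n. C i)"
    proof (rule P.finite_Lim_measure_incseq)
      show "range (\<lambda>n. \<Union>i\<le>n. C i) \<subseteq> sets P"
        using closed(1) by (auto simp: sets intro!: closedin_imp_sets_borel_of closedin_Union)
      show "incseq (\<lambda>n. \<Union>i\<le>n. C i)"
        unfolding incseq_def by (intro allI impI UN_mono) auto
    qed
    then show ?thesis
      unfolding U_eq[symmetric] by (rule LIMSEQ_le_const2) (use bound in auto)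
  qed
  interpret P: prob_space P using P by (simp add: borel_prob_def)
  interpret Q: prob_space Q using Q by (simp add: borel_prob_def)
  have sets: "sets P = sets (borel_of X)" "sets Q = sets (borel_of X)"
    using P Q by (auto simp: borel_prob_def)
  show ?thesis
  proof (rule measure_eqI_generator_eq[where E="{U. openin X U}" and \<Omega>="topspace X" and A="\<lambda>_. topspace X"])
    show "Int_stable {U. openin X U}"
      by (auto simp: Int_stable_def)
    show "{U. openin X U} \<subseteq> Pow (topspace X)"
      by (auto dest: openin_subset)
    show "emeasure P U = emeasure Q U" if "U \<in> {U. openin X U}" for U
      using le[OF P Q _ eq] le[OF Q P _ eq[symmetric]] that
      by (simp add: P.emeasure_eq_measure Q.emeasure_eq_measure antisym)
  qed (auto simp: sets sets_borel_of)
qed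

section \<open>Averaging over redrawn coordinates\<close>

locale stochastic_equation =
  fixes G :: "nat \<Rightarrow> ('a, 'b) monoid_scheme"
    and T :: "nat \<Rightarrow> 'a topology"
    and \<phi> :: "nat \<Rightarrow> 'a \<Rightarrow> 'a"
    and \<mu> :: "nat \<Rightarrow> 'a measure"
  assumes compact_group: "\<And>k. compact_second_countable_group (G k) (T k)"
    and hom: "\<And>k. \<phi> k \<in> hom (G (Suc k)) (G k)"
    and continuous_hom: "\<And>k. continuous_map (T (Suc k)) (T k) (\<phi> k)"
    and noise: "\<And>k. \<mu> k \<in> borel_prob (T k)"
begin

abbreviation seq_space :: "(nat \<Rightarrow> 'a) measure" where
  "seq_space \<equiv> \<Pi>\<^sub>M k\<in>UNIV. borel_of (T k)"

abbreviation seq_top :: "(nat \<Rightarrow> 'a) topology" where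
  "seq_top \<equiv> seq_topology T"

definition redraw :: "nat \<Rightarrow> (nat \<Rightarrow> 'a) \<Rightarrow> 'a \<Rightarrow> nat \<Rightarrow> 'a" where
  "redraw k x z = x(k := \<phi> k (x (Suc k)) \<otimes>\<^bsub>G k\<^esub> z)"

definition forget :: "nat \<Rightarrow> (nat \<Rightarrow> 'a) \<Rightarrow> nat \<Rightarrow> 'a" where
  "forget n x = (\<lambda>k. if k < n then \<one>\<^bsub>G k\<^esub> else x k)"

text \<open>The bounded Borel functions of the coordinates from \<open>n\<close> on. They are kept as functions on
  the full sequence space, so that the \<open>observables n\<close> form a decreasing family.\<close>

definition observables :: "nat \<Rightarrow> ((nat \<Rightarrow> 'a) \<Rightarrow> real) set" where
  "observables n = {f \<in> borel_measurable seq_space.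
     (\<exists>B. \<forall>x\<in>space seq_space. \<bar>f x\<bar> \<le> B) \<and> (\<forall>x\<in>space seq_space. f (forget n x) = f x)}"

definition step :: "nat \<Rightarrow> ((nat \<Rightarrow> 'a) \<Rightarrow> real) \<Rightarrow> (nat \<Rightarrow> 'a) \<Rightarrow> real" where
  "step k f x = (\<integral>z. f (redraw k x z) \<partial>\<mu> k)"

text \<open>For bounded Borel \<open>f\<close> and every solution this is a version of the conditional expectation
  of \<open>f\<close> given the coordinates from \<open>n\<close> on; the formula itself refers to the noise only.\<close>

fun average :: "nat \<Rightarrow> ((nat \<Rightarrow> 'a) \<Rightarrow> real) \<Rightarrow> (nat \<Rightarrow> 'a) \<Rightarrow> real" where
  "average 0 f = f"
| "average (Suc n) f = step n (average n f)"

lemma group: "group (G k)"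
  using compact_group[of k]
  by (simp add: compact_second_countable_group_def topological_group_def)

lemma topspace_eq: "topspace (T k) = carrier (G k)"
  using topological_group.topspace_eq_carrier compact_group[of k]
  by (auto simp: compact_second_countable_group_def)

lemma second_countable: "second_countable (T k)"
  using compact_second_countable_group.second_countable[OF compact_group] .

lemma space_borel: "space (borel_of (T k)) = carrier (G k)"
  by (simp add: space_borel_of topspace_eq)

lemma space_seq: "x \<in> space seq_space \<longleftrightarrow> (\<forall>k. x k \<in> carrier (G k))"
  by (simp add: space_PiM space_borel PiE_iff)

lemma topspace_seq: "topspace (seq_topology T) = space seq_space"
  by (simp add: space_PiM space_borel_of)

lemma sets_seq: "sets (borel_of (seq_topology T)) = sets seq_space"
  by (rule sets_borel_of_seq_topology) (rule second_countable)

lemma prob_space_noise: "prob_space (\<mu> k)"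
  and sets_noise [measurable_cong]: "sets (\<mu> k) = sets (borel_of (T k))"
  and space_noise: "space (\<mu> k) = carrier (G k)"
  using noise[of k] sets_eq_imp_space_eq[of "\<mu> k" "borel_of (T k)"]
  by (auto simp: borel_prob_def space_borel)

lemma one_closed: "\<one>\<^bsub>G k\<^esub> \<in> carrier (G k)"
  and mult_closed: "x \<in> carrier (G k) \<Longrightarrow> y \<in> carrier (G k) \<Longrightarrow> x \<otimes>\<^bsub>G k\<^esub> y \<in> carrier (G k)"
  and inv_closed: "x \<in> carrier (G k) \<Longrightarrow> inv\<^bsub>G k\<^esub> x \<in> carrier (G k)"
  using group[of k] by (simp_all add: group.is_monoid monoid.one_closed monoid.m_closed group.inv_closed)

lemma hom_closed: "x \<in> carrier (G (Suc k)) \<Longrightarrow> \<phi> k x \<in> carrier (G k)"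
  using hom[of k] by (auto simp: hom_def)

lemma measurable_hom [measurable]: "\<phi> k \<in> borel_of (T (Suc k)) \<rightarrow>\<^sub>M borel_of (T k)"
  by (rule continuous_map_measurable[OF continuous_hom])

text \<open>Continuity gives measurability for the Borel sets of the product topology. These belong to
  the product \<open>\<sigma>\<close>-algebra by second countability.\<close>

lemma measurable_group_mult:
  "(\<lambda>(x, y). x \<otimes>\<^bsub>G k\<^esub> y) \<in> borel_of (T k) \<Otimes>\<^sub>M borel_of (T k) \<rightarrow>\<^sub>M borel_of (T k)"
proof -
  have "(\<lambda>(x, y). x \<otimes>\<^bsub>G k\<^esub> y) \<in> borel_of (prod_topology (T k) (T k)) \<rightarrow>\<^sub>M borel_of (T k)"
    using topological_group.continuous_map_mult[of "G k" "T k"] compact_group[of k]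
    by (intro continuous_map_measurable) (simp add: compact_second_countable_group_def)
  then show ?thesis
    using sets_borel_of_prod_topology[OF second_countable second_countable, of k k]
    by (auto simp: measurable_def space_borel_of space_pair_measure)
qed

lemma measurable_redraw [measurable]:
  "(\<lambda>(x, z). redraw k x z) \<in> seq_space \<Otimes>\<^sub>M borel_of (T k) \<rightarrow>\<^sub>M seq_space"
proof -
  have "(\<lambda>(x, z). (\<phi> k (x (Suc k)), z)) \<in> seq_space \<Otimes>\<^sub>M borel_of (T k) \<rightarrow>\<^sub>M borel_of (T k) \<Otimes>\<^sub>M borel_of (T k)"
    by measurable
  from measurable_compose[OF this measurable_group_mult]
  have *: "(\<lambda>(x, z). \<phi> k (x (Suc k)) \<otimes>\<^bsub>G k\<^esub> z) \<in> seq_space \<Otimes>\<^sub>M borel_of (T k) \<rightarrow>\<^sub>M borel_of (T k)"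
    by (simp add: case_prod_beta')
  show ?thesis
    unfolding redraw_def case_prod_beta'
    by (rule measurable_fun_upd[where J=UNIV]) (use * in \<open>simp_all add: case_prod_beta'\<close>)
qed

lemma measurable_forget: "forget n \<in> seq_space \<rightarrow>\<^sub>M seq_space"
proof (rule measurable_PiM_single')
  show "(\<lambda>x. forget n x k) \<in> seq_space \<rightarrow>\<^sub>M borel_of (T k)" for k
    by (cases "k < n") (simp_all add: forget_def space_borel one_closed)
qed (auto simp: forget_def space_seq one_closed space_borel PiE_iff)

lemma redraw_closed: "x \<in> space seq_space \<Longrightarrow> z \<in> carrier (G k) \<Longrightarrow> redraw k x z \<in> space seq_space"
  by (auto simp: space_seq redraw_def mult_closed hom_closed)

lemma forget_closed: "x \<in> space seq_space \<Longrightarrow> forget n x \<in> space seq_space"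
  by (auto simp: space_seq forget_def one_closed)

lemma forget_forget: "m \<le> n \<Longrightarrow> forget n (forget m x) = forget n x"
  by (auto simp: forget_def fun_eq_iff)

lemma forget_0: "forget 0 x = x"
  by (simp add: forget_def)

lemma forget_redraw: "forget (Suc k) (redraw k x z) = forget (Suc k) x"
  by (auto simp: forget_def redraw_def fun_eq_iff)

lemma forget_redraw_forget: "forget k (redraw k (forget (Suc k) x) z) = forget k (redraw k x z)"
  by (auto simp: forget_def redraw_def fun_eq_iff)

lemma observablesD:
  assumes "f \<in> observables n"
  shows "f \<in> borel_measurable seq_space"
    and "\<exists>B. \<forall>x\<in>space seq_space. \<bar>f x\<bar> \<le> B"
    and "x \<in> space seq_space \<Longrightarrow> f (forget n x) = f x"
  using assms by (auto simp: observables_def)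

lemma observables_0: "f \<in> observables 0 \<longleftrightarrow>
    f \<in> borel_measurable seq_space \<and> (\<exists>B. \<forall>x\<in>space seq_space. \<bar>f x\<bar> \<le> B)"
  by (auto simp: observables_def forget_0)

lemma observables_antimono: "m \<le> n \<Longrightarrow> f \<in> observables n \<Longrightarrow> f \<in> observables m"
  unfolding observables_def by (auto simp: forget_forget) (metis forget_closed forget_forget)

lemma observables_mult: 
  assumes "f \<in> observables n" "g \<in> observables n" shows "(\<lambda>x. f x * g x) \<in> observables n"
proof -
  obtain A B where "\<forall>x\<in>space seq_space. \<bar>f x\<bar> \<le> A" "\<forall>x\<in>space seq_space. \<bar>g x\<bar> \<le> B"
    using assms[THEN observablesD(2)] by blast
  then have "\<forall>x\<in>space seq_space. \<bar>f x * g x\<bar> \<le> A * B"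
    by (auto simp: abs_mult intro!: mult_mono intro: order_trans[OF abs_ge_zero])
  then show ?thesis using assms unfolding observables_def by auto
qed

lemma observables_add: 
  assumes "f \<in> observables n" "g \<in> observables n" shows "(\<lambda>x. f x + g x) \<in> observables n"
proof -
  obtain A B where "\<forall>x\<in>space seq_space. \<bar>f x\<bar> \<le> A" "\<forall>x\<in>space seq_space. \<bar>g x\<bar> \<le> B"
    using assms[THEN observablesD(2)] by blast
  then have "\<forall>x\<in>space seq_space. \<bar>f x + g x\<bar> \<le> A + B"
    by (fastforce intro: order_trans[OF abs_triangle_ineq] add_mono)
  then show ?thesis using assms unfolding observables_def by auto
qed

lemma observables_const: "(\<lambda>_. c) \<in> observables n"
  by (auto simp: observables_def)

lemma integrable_observable:
  assumes "f \<in> observables n" "prob_space P" "sets P = sets seq_space"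
  shows "integrable P f"
proof -
  interpret prob_space P by fact
  obtain B where "\<forall>x\<in>space seq_space. \<bar>f x\<bar> \<le> B"
    using observablesD(2)[OF assms(1)] by blast
  then show ?thesis
    using observablesD(1)[OF assms(1)] sets_eq_imp_space_eq[OF assms(3)] assms(3)
    by (intro integrable_const_bound[where B=B] AE_I2) (auto cong: measurable_cong_sets)
qed

lemma measurable_redraw_observable:
  assumes "f \<in> borel_measurable seq_space"
  shows "(\<lambda>(x, z). f (redraw k x z)) \<in> borel_measurable (seq_space \<Otimes>\<^sub>M borel_of (T k))"
  using measurable_compose[OF measurable_redraw assms, of k] by (simp add: case_prod_beta')

lemma integrable_redraw:
  assumes "f \<in> observables n" "x \<in> space seq_space"
  shows "integrable (\<mu> k) (\<lambda>z. f (redraw k x z))"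
proof -
  interpret prob_space "\<mu> k" by (rule prob_space_noise)
  obtain B where "\<forall>x\<in>space seq_space. \<bar>f x\<bar> \<le> B"
    using observablesD(2)[OF assms(1)] by blast
  moreover have "(\<lambda>z. f (redraw k x z)) \<in> borel_measurable (\<mu> k)"
    using measurable_compose[OF measurable_Pair1'[OF assms(2)] measurable_redraw_observable[OF observablesD(1)[OF assms(1)]], of k]
    by (simp cong: measurable_cong_sets)
  ultimately show ?thesis
    using assms(2) by (intro integrable_const_bound[where B=B] AE_I2) (auto simp: redraw_closed space_noise)
qed

lemma step_cong:
  assumes "\<And>x. x \<in> space seq_space \<Longrightarrow> f x = g x" "x \<in> space seq_space"
  shows "step k f x = step k g x"
  unfolding step_def using assms by (intro Bochner_Integration.integral_cong) (auto simp: redraw_closed space_noise)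

lemma step_const: "step k (\<lambda>_. c) x = c"
  using prob_space.prob_space[OF prob_space_noise, of k] by (simp add: step_def)

lemma step_close:
  assumes f: "f \<in> observables n" and g: "g \<in> observables n" and x: "x \<in> space seq_space"
    and close: "\<And>x. x \<in> space seq_space \<Longrightarrow> \<bar>f x - g x\<bar> \<le> \<epsilon>"
  shows "\<bar>step k f x - step k g x\<bar> \<le> \<epsilon>"
proof -
  interpret prob_space "\<mu> k" by (rule prob_space_noise)
  show ?thesis
    unfolding step_def
    by (intro integral_close integrable_redraw[OF f x] integrable_redraw[OF g x] close redraw_closed[OF x])
      (simp add: space_noise)
qed

lemma step_observable:
  assumes f: "f \<in> observables k"
  shows "step k f \<in> observables (Suc k)"
proof -
  interpret prob_space "\<mu> k" by (rule prob_space_noise)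
  obtain B where B: "\<And>x. x \<in> space seq_space \<Longrightarrow> \<bar>f x - 0\<bar> \<le> B"
    using observablesD(2)[OF f] by auto
  have "(\<lambda>(x, z). f (redraw k x z)) \<in> borel_measurable (seq_space \<Otimes>\<^sub>M \<mu> k)"
    using measurable_redraw_observable[OF observablesD(1)[OF f], of k]
    by (simp cong: measurable_cong_sets sets_pair_measure_cong add: sets_noise)
  then have "step k f \<in> borel_measurable seq_space"
    unfolding step_def[abs_def] by (rule borel_measurable_lebesgue_integral)
  moreover have "\<bar>step k f x\<bar> \<le> B" if "x \<in> space seq_space" for x
    using step_close[OF f observables_const that B] by (simp add: step_const)
  moreover have "step k f (forget (Suc k) x) = step k f x" if "x \<in> space seq_space" for x
    unfolding step_def
  proof (rule Bochner_Integration.integral_cong)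
    fix z assume "z \<in> space (\<mu> k)"
    then show "f (redraw k (forget (Suc k) x) z) = f (redraw k x z)"
      using that observablesD(3)[OF f]
      by (metis forget_closed forget_redraw_forget redraw_closed space_noise)
  qed simp
  ultimately show ?thesis
    by (auto simp: observables_def)
qed

lemma step_mult:
  assumes "w \<in> observables (Suc k)" "x \<in> space seq_space"
  shows "step k (\<lambda>x. f x * w x) x = step k f x * w x"
proof -
  have "w (redraw k x z) = w x" if "z \<in> carrier (G k)" for z
    using observablesD(3)[OF assms(1)] redraw_closed[OF assms(2) that] assms(2)
    by (metis forget_redraw)
  then have "step k (\<lambda>x. f x * w x) x = (\<integral>z. f (redraw k x z) * w x \<partial>\<mu> k)"
    unfolding step_def by (intro Bochner_Integration.integral_cong) (auto simp: space_noise)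
  then show ?thesis
    by (simp add: step_def)
qed

lemma average_observable: "f \<in> observables 0 \<Longrightarrow> average n f \<in> observables n"
  by (induction n) (auto intro: step_observable)

lemma average_close:
  assumes "f \<in> observables 0" "g \<in> observables 0"
    and "\<And>x. x \<in> space seq_space \<Longrightarrow> \<bar>f x - g x\<bar> \<le> \<epsilon>" "x \<in> space seq_space"
  shows "\<bar>average n f x - average n g x\<bar> \<le> \<epsilon>"
  using assms(4)
proof (induction n arbitrary: x)
  case (Suc n)
  then show ?case
    using step_close[OF average_observable[OF assms(1)] average_observable[OF assms(2)]] by simp
qed (use assms in simp)

text \<open>Pulling out what is known: redrawing the coordinates below \<open>n\<close> leaves \<open>w\<close> unchanged, so
  the identity holds at every point and not only almost surely.\<close>

lemma average_mult:
  assumes "w \<in> observables n" "x \<in> space seq_space"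
  shows "average n (\<lambda>x. f x * w x) x = average n f x * w x"
  using assms
proof (induction n arbitrary: x)
  case (Suc n)
  have "w \<in> observables n" by (rule observables_antimono[OF _ Suc.prems(1)]) simp
  then have "step n (average n (\<lambda>x. f x * w x)) x = step n (\<lambda>x. average n f x * w x) x"
    using Suc by (intro step_cong) auto
  then show ?case
    using step_mult[OF Suc.prems] by simp
qed simp

text \<open>This lemma and the next one translate between invariance under \<open>forget\<close> and measurability
  for \<open>future_algebra\<close>. The index shifts by one, as \<open>future_algebra T k\<close> is generated by the coordinates
  strictly after \<open>k\<close>.\<close>

lemma observable_future_measurable:
  assumes "w \<in> observables (Suc k)"
  shows "w \<in> borel_measurable (future_algebra T k)"
proof -
  define R where "R = (\<lambda>x :: nat \<Rightarrow> 'a. \<lambda>j\<in>{k<..}. x j)"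
  have space: "space (future_algebra T k) = space seq_space"
    by (simp only: future_algebra_def space_vimage_algebra topspace_seq)
  have R: "R \<in> future_algebra T k \<rightarrow>\<^sub>M (\<Pi>\<^sub>M j\<in>{k<..}. borel_of (T j))"
    unfolding future_algebra_def R_def
    by (rule measurable_vimage_algebra1) (auto simp: space_PiM space_borel_of PiE_iff)
  have "forget (Suc k) \<in> future_algebra T k \<rightarrow>\<^sub>M seq_space"
  proof (rule measurable_PiM_single')
    fix j
    show "(\<lambda>x. forget (Suc k) x j) \<in> future_algebra T k \<rightarrow>\<^sub>M borel_of (T j)"
    proof (cases "j < Suc k")
      case False
      then have "(\<lambda>x. R x j) \<in> future_algebra T k \<rightarrow>\<^sub>M borel_of (T j)"
        using measurable_compose[OF R measurable_component_singleton[of j]] by simp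
      then show ?thesis using False by (simp add: R_def forget_def)
    qed (simp add: forget_def space_borel one_closed)
  qed (auto simp: forget_def space space_seq one_closed space_borel PiE_iff)
  from measurable_compose[OF this observablesD(1)[OF assms]] show ?thesis
    by (subst measurable_cong[where g="\<lambda>x. w (forget (Suc k) x)"])
      (simp_all add: space observablesD(3)[OF assms])
qed

lemma future_set_observable:
  assumes "A \<in> sets (future_algebra T k)"
  shows "indicator A \<in> observables (Suc k)"
proof -
  define R where "R = (\<lambda>x :: nat \<Rightarrow> 'a. \<lambda>j\<in>{k<..}. x j)"
  have R: "R \<in> seq_space \<rightarrow>\<^sub>M (\<Pi>\<^sub>M j\<in>{k<..}. borel_of (T j))"
    unfolding R_def by (intro measurable_restrict measurable_component_singleton) simp
  have "R \<in> space seq_space \<rightarrow> space (\<Pi>\<^sub>M j\<in>{k<..}. borel_of (T j))"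
    using measurable_space[OF R] by auto
  then obtain B where B: "B \<in> sets (\<Pi>\<^sub>M j\<in>{k<..}. borel_of (T j))" "A = R -` B \<inter> space seq_space"
    using assms unfolding future_algebra_def topspace_seq R_def[symmetric] by (auto simp: sets_vimage_algebra2)
  have "A \<in> sets seq_space"
    using measurable_sets[OF R B(1)] by (simp add: B(2))
  moreover have "R (forget (Suc k) x) = R x" for x
    by (auto simp: R_def forget_def fun_eq_iff)
  ultimately show ?thesis
    by (auto simp: observables_def B(2) indicator_def forget_closed intro!: exI[of _ 1])
qed

section \<open>Solutions are the measures that every step preserves\<close>

lemma solutionD:
  assumes "P \<in> solutions G T \<phi> \<mu>"
  shows "P \<in> borel_prob (seq_topology T)" "prob_space P" "sets P = sets seq_space" "space P = space seq_space"
proof -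
  show "P \<in> borel_prob (seq_topology T)" "prob_space P" and sets: "sets P = sets seq_space"
    using assms by (auto simp: solutions_def borel_prob_def sets_seq)
  from sets_eq_imp_space_eq[OF sets] show "space P = space seq_space" .
qed

lemma coordinate_observable:
  assumes "f \<in> borel_measurable (borel_of (T k))" "\<And>y. y \<in> carrier (G k) \<Longrightarrow> \<bar>f y\<bar> \<le> B"
  shows "(\<lambda>x. f (x k)) \<in> observables k"
  using assms measurable_compose[OF measurable_component_singleton[of k UNIV "\<lambda>k. borel_of (T k)"] assms(1)]
  by (auto simp: observables_def forget_def space_seq intro!: exI[of _ B])

lemma step_coordinate: "step k (\<lambda>x. f (x k)) x = (\<integral>z. f (\<phi> k (x (Suc k)) \<otimes>\<^bsub>G k\<^esub> z) \<partial>\<mu> k)"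
  by (simp add: step_def redraw_def)

text \<open>The conditional expectation in the definition of a solution, tested against a bounded
  function \<open>w\<close> of the future.\<close>

lemma solution_step_coordinate:
  assumes P: "P \<in> solutions G T \<phi> \<mu>"
    and f: "f \<in> borel_measurable (borel_of (T k))" "\<And>y. y \<in> carrier (G k) \<Longrightarrow> \<bar>f y\<bar> \<le> B"
    and w: "w \<in> observables (Suc k)"
  shows "(\<integral>x. w x * f (x k) \<partial>P) = (\<integral>x. w x * step k (\<lambda>x. f (x k)) x \<partial>P)"
proof -
  interpret P: prob_space P by (rule solutionD[OF P])
  note sets = solutionD(3)[OF P]
  interpret finite_measure_subalgebra P "future_algebra T k"
    by unfold_locales (rule subalgebra_future_algebra[OF solutionD(1)[OF P]])
  have obs: "(\<lambda>x. f (x k)) \<in> observables k"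
    by (rule coordinate_observable[OF f])
  have w': "w \<in> observables k"
    by (rule observables_antimono[OF _ w]) simp
  have [measurable]: "step k (\<lambda>x. f (x k)) \<in> borel_measurable P" "w \<in> borel_measurable P"
      "(\<lambda>x. f (x k)) \<in> borel_measurable P"
    using observablesD(1)[OF step_observable[OF obs]] observablesD(1)[OF w] observablesD(1)[OF obs]
    by (simp_all add: sets cong: measurable_cong_sets)
  have "AE x in P. real_cond_exp P (future_algebra T k) (\<lambda>x. f (x k)) x = step k (\<lambda>x. f (x k)) x"
    using P f unfolding solutions_def step_coordinate by blast
  then have "(\<integral>x. w x * step k (\<lambda>x. f (x k)) x \<partial>P) =
      (\<integral>x. w x * real_cond_exp P (future_algebra T k) (\<lambda>x. f (x k)) x \<partial>P)"
    by (intro integral_cong_AE) auto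
  also have "\<dots> = (\<integral>x. w x * f (x k) \<partial>P)"
    by (rule real_cond_exp_intg(2))
      (use integrable_observable[OF observables_mult[OF w' obs] solutionD(2,3)[OF P]]
        observable_future_measurable[OF w] in auto)
  finally show ?thesis ..
qed

text \<open>The two sides are the integrals of \<open>f\<close> with respect to the laws of the coordinates from
  \<open>k\<close> on, before and after coordinate \<open>k\<close> is redrawn. It suffices to compare these laws on boxes,
  whose indicators split into a function of \<open>x k\<close> and a function of the future, and there
  \<open>solution_step_coordinate\<close> applies.\<close>

lemma solution_step:
  assumes P: "P \<in> solutions G T \<phi> \<mu>" and f: "f \<in> observables k"
  shows "(\<integral>x. f x \<partial>P) = (\<integral>x. step k f x \<partial>P)"
proof -
  interpret P: prob_space P by (rule solutionD[OF P])
  interpret \<mu>: prob_space "\<mu> k" by (rule prob_space_noise)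
  interpret PR: pair_prob_space P "\<mu> k" ..
  note sets_P [measurable_cong] = solutionD(3)[OF P]
  note space_P = solutionD(4)[OF P]
  note [measurable] = measurable_forget
  have meas_redraw [measurable]: "(\<lambda>(x, z). forget k (redraw k x z)) \<in> P \<Otimes>\<^sub>M \<mu> k \<rightarrow>\<^sub>M seq_space"
    using measurable_compose[OF measurable_redraw measurable_forget, of k k]
    by (simp add: case_prod_beta' sets_P sets_noise cong: measurable_cong_sets sets_pair_measure_cong)
  have meas_forget [measurable]: "forget k \<in> P \<rightarrow>\<^sub>M seq_space"
    by measurable
  \<comment> \<open>Both laws live on the full sequence space, with the coordinates below \<open>k\<close> set to the unit.\<close>
  define Q where "Q = distr P seq_space (forget k)"
  define R where "R = distr (P \<Otimes>\<^sub>M \<mu> k) seq_space (\<lambda>(x, z). forget k (redraw k x z))"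
  interpret Q: prob_space Q
    unfolding Q_def by (rule P.prob_space_distr) measurable
  interpret R: prob_space R
    unfolding R_def by (rule PR.P.prob_space_distr) measurable
  have iter: "(\<integral>x. g x \<partial>R) = (\<integral>x. step k (\<lambda>x. g (forget k x)) x \<partial>P)"
    if g: "g \<in> observables 0" for g :: "(nat \<Rightarrow> 'a) \<Rightarrow> real"
  proof -
    obtain B where B: "\<And>x. x \<in> space seq_space \<Longrightarrow> \<bar>g x\<bar> \<le> B"
      using observablesD(2)[OF g] by auto
    note [measurable] = observablesD(1)[OF g]
    have int: "integrable (P \<Otimes>\<^sub>M \<mu> k) (\<lambda>(x, z). g (forget k (redraw k x z)))"
    proof (rule PR.P.integrable_const_bound[where B=B])
      show "AE x in P \<Otimes>\<^sub>M \<mu> k. norm (case x of (x, z) \<Rightarrow> g (forget k (redraw k x z))) \<le> B"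
        by (auto intro!: AE_I2 B forget_closed redraw_closed simp: space_pair_measure space_P space_noise)
      show "(\<lambda>(x, z). g (forget k (redraw k x z))) \<in> borel_measurable (P \<Otimes>\<^sub>M \<mu> k)"
        using measurable_compose[OF meas_redraw observablesD(1)[OF g]] by (simp add: case_prod_beta')
    qed
    have "(\<integral>x. g x \<partial>R) = (\<integral>p. (case p of (x, z) \<Rightarrow> g (forget k (redraw k x z))) \<partial>(P \<Otimes>\<^sub>M \<mu> k))"
      unfolding R_def by (subst integral_distr) (auto simp: case_prod_beta')
    also have "\<dots> = (\<integral>x. \<integral>z. g (forget k (redraw k x z)) \<partial>\<mu> k \<partial>P)"
      using PR.integral_fst'[OF int] by simp
    finally show ?thesis
      by (simp add: step_def)
  qed
  have "Q = R"
  proof (rule measure_eqI_PiM_infinite)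
    show "sets Q = sets seq_space" "sets R = sets seq_space" "finite_measure Q"
      by (simp_all add: Q_def R_def Q.finite_measure_axioms[unfolded Q_def])
    fix A J assume J: "finite J" "J \<subseteq> UNIV" and A: "\<And>i. i \<in> J \<Longrightarrow> A i \<in> sets (borel_of (T i))"
    define E where "E = prod_emb UNIV (\<lambda>k. borel_of (T k)) J (Pi\<^sub>E J A)"
    have E: "E \<in> sets seq_space"
      unfolding E_def using J A by (intro sets_PiM_I) auto
    have E_iff: "x \<in> E \<longleftrightarrow> (\<forall>j\<in>J. x j \<in> A j)" if "x \<in> space seq_space" for x
      using that by (auto simp: E_def prod_emb_iff space_PiM PiE_iff restrict_def extensional_def)
    \<comment> \<open>The indicator of the box factors: \<open>c\<close> collects the sides below \<open>k\<close>, which see only the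
      units, \<open>A'\<close> is the side at \<open>k\<close>, and \<open>B\<close> collects the sides after \<open>k\<close>.\<close>
    define c :: real where "c = (if \<forall>j\<in>J. j < k \<longrightarrow> \<one>\<^bsub>G j\<^esub> \<in> A j then 1 else 0)"
    define A' where "A' = (if k \<in> J then A k else space (borel_of (T k)))"
    define B where "B = {x \<in> space seq_space. \<forall>j\<in>J. k < j \<longrightarrow> x j \<in> A j}"
    have A': "A' \<in> sets (borel_of (T k))"
      using A by (auto simp: A'_def)
    have "B = (\<Inter>j\<in>{j\<in>J. k < j}. {x \<in> space seq_space. x j \<in> A j}) \<inter> space seq_space"
      by (auto simp: B_def)
    also have "\<dots> \<in> sets seq_space"
    proof (cases "{j\<in>J. k < j} = {}")
      case False
      then show ?thesis
        using A J(1) by (intro sets.Int sets.finite_INT) (auto intro: measurable_sets_Collect)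
    next
      case True
      show ?thesis unfolding True by simp
    qed
    finally have B: "B \<in> sets seq_space" .
    define w where "w x = c * indicator B x" for x
    have "forget (Suc k) x \<in> B \<longleftrightarrow> x \<in> B" if "x \<in> space seq_space" for x
    proof -
      have "forget (Suc k) x j = x j" if "k < j" for j
        using that by (simp add: forget_def)
      then show ?thesis
        using that forget_closed[OF that] by (simp add: B_def)
    qed
    then have "(indicator B :: _ \<Rightarrow> real) \<in> observables (Suc k)"
      using B by (auto simp: observables_def indicator_def intro!: exI[of _ 1])
    then have w: "w \<in> observables (Suc k)"
      unfolding w_def[abs_def] by (intro observables_mult observables_const)
    have ind: "indicator E (forget k x) = w x * indicator A' (x k)" if "x \<in> space seq_space" for x
    proof -
      have "forget k x \<in> E \<longleftrightarrow> (\<forall>j\<in>J. j < k \<longrightarrow> \<one>\<^bsub>G j\<^esub> \<in> A j) \<and> (x \<in> B) \<and> x k \<in> A'"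
      proof -
        have "x k \<in> A' \<longleftrightarrow> (k \<in> J \<longrightarrow> x k \<in> A k)"
          using that by (simp add: A'_def space_borel space_seq)
        moreover have "x \<in> B \<longleftrightarrow> (\<forall>j\<in>J. k < j \<longrightarrow> x j \<in> A j)"
          using that by (simp add: B_def)
        moreover have "forget k x j \<in> A j \<longleftrightarrow>
            (j < k \<longrightarrow> \<one>\<^bsub>G j\<^esub> \<in> A j) \<and> (j = k \<longrightarrow> x k \<in> A k) \<and> (k < j \<longrightarrow> x j \<in> A j)" for j
          by (cases j k rule: linorder_cases) (simp_all add: forget_def)
        ultimately show ?thesis
          unfolding E_iff[OF forget_closed[OF that]] by blast
      qed
      then show ?thesis
        by (auto simp: w_def c_def indicator_def)
    qed
    have ind_obs: "(indicator E :: _ \<Rightarrow> real) \<in> observables 0"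
      using E by (auto simp: observables_0 indicator_def intro!: exI[of _ 1])
    have sets_QR: "E \<in> sets Q" "E \<in> sets R"
      using E by (simp_all add: Q_def R_def)
    have "measure Q E = (\<integral>x. indicator E x \<partial>Q)"
      using sets_QR sets.sets_into_space by (simp add: Int_absorb2)
    also have "\<dots> = (\<integral>x. indicator E (forget k x) \<partial>P)"
      unfolding Q_def using E by (subst integral_distr) auto
    also have "\<dots> = (\<integral>x. w x * indicator A' (x k) \<partial>P)"
      by (intro Bochner_Integration.integral_cong) (auto simp: ind space_P)
    also have "\<dots> = (\<integral>x. w x * step k (\<lambda>x. indicator A' (x k)) x \<partial>P)"
      by (rule solution_step_coordinate[OF P _ _ w, where B=1]) (use A' in auto)
    also have "\<dots> = (\<integral>x. step k (\<lambda>x. indicator E (forget k x)) x \<partial>P)"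
    proof (rule Bochner_Integration.integral_cong)
      fix x assume x: "x \<in> space P"
      then show "w x * step k (\<lambda>x. indicator A' (x k)) x = step k (\<lambda>x. indicator E (forget k x)) x"
        using step_mult[OF w, of x "\<lambda>x. indicator A' (x k)"]
          step_cong[of "\<lambda>x. indicator E (forget k x)" "\<lambda>x. indicator A' (x k) * w x" x k]
        by (simp add: ind space_P mult.commute)
    qed simp
    also have "\<dots> = measure R E"
      using iter[OF ind_obs] sets_QR sets.sets_into_space by (simp add: Int_absorb2)
    finally show "emeasure Q E = emeasure R E"
      by (simp add: Q.emeasure_eq_measure R.emeasure_eq_measure)
  qed
  have f0: "f \<in> observables 0"
    by (rule observables_antimono[OF _ f]) simp
  have "(\<integral>x. f x \<partial>P) = (\<integral>x. f (forget k x) \<partial>P)"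
    by (intro Bochner_Integration.integral_cong) (auto simp: observablesD(3)[OF f] space_P)
  also have "\<dots> = (\<integral>x. f x \<partial>R)"
    using observablesD(1)[OF f] by (simp add: \<open>Q = R\<close>[symmetric] Q_def integral_distr)
  also have "\<dots> = (\<integral>x. step k (\<lambda>x. f (forget k x)) x \<partial>P)"
    by (rule iter[OF f0])
  also have "\<dots> = (\<integral>x. step k f x \<partial>P)"
    by (intro Bochner_Integration.integral_cong step_cong) (auto simp: observablesD(3)[OF f] space_P)
  finally show ?thesis .
qed

text \<open>Applying invariance to \<open>f (x k)\<close> times the indicator of a set from the future algebra gives
  the defining property of the conditional expectation.\<close>

lemma solutionI_step:
  assumes P: "prob_space P" "sets P = sets seq_space"
    and step: "\<And>k f. f \<in> observables k \<Longrightarrow> (\<integral>x. f x \<partial>P) = (\<integral>x. step k f x \<partial>P)"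
  shows "P \<in> solutions G T \<phi> \<mu>"
proof -
  interpret P: prob_space P by fact
  have space_P: "space P = space seq_space"
    by (rule sets_eq_imp_space_eq[OF P(2)])
  have bp: "P \<in> borel_prob (seq_topology T)"
    using P by (simp add: borel_prob_def sets_seq)
  have "AE x in P. real_cond_exp P (future_algebra T k) (\<lambda>x. f (x k)) x = step k (\<lambda>x. f (x k)) x"
    if f: "f \<in> borel_measurable (borel_of (T k))" "\<And>y. y \<in> carrier (G k) \<Longrightarrow> \<bar>f y\<bar> \<le> B" for k f B
  proof -
    interpret finite_measure_subalgebra P "future_algebra T k"
      by unfold_locales (rule subalgebra_future_algebra[OF bp])
    have obs: "(\<lambda>x. f (x k)) \<in> observables k"
      by (rule coordinate_observable[OF f])
    note step_obs = step_observable[OF obs]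
    show ?thesis
    proof (rule real_cond_exp_charact)
      fix A assume "A \<in> sets (future_algebra T k)"
      then have A: "indicator A \<in> observables (Suc k)"
        by (rule future_set_observable)
      then have "indicator A \<in> observables k"
        by (rule observables_antimono[rotated]) simp
      then have "(\<integral>x. f (x k) * indicator A x \<partial>P) = (\<integral>x. step k (\<lambda>x. f (x k) * indicator A x) x \<partial>P)"
        by (intro step observables_mult obs)
      also have "\<dots> = (\<integral>x. step k (\<lambda>x. f (x k)) x * indicator A x \<partial>P)"
        by (intro Bochner_Integration.integral_cong step_mult A) (auto simp: space_P)
      finally show "(\<integral>x\<in>A. f (x k) \<partial>P) = (\<integral>x\<in>A. step k (\<lambda>x. f (x k)) x \<partial>P)"
        by (simp add: set_lebesgue_integral_def mult.commute)
    qed (use integrable_observable[OF obs P] integrable_observable[OF step_obs P]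
        observable_future_measurable[OF step_obs] in auto)
  qed
  then show ?thesis
    using bp unfolding solutions_def step_coordinate by blast
qed

section \<open>Averages under an extreme solution become constant\<close>

lemma average_const: "average n (\<lambda>_. c) = (\<lambda>_. c)"
proof (induction n)
  case (Suc n)
  then show ?case
    by (simp add: ext[of "step n (\<lambda>_. c)", OF step_const])
qed simp

lemma integral_average:
  assumes P: "P \<in> solutions G T \<phi> \<mu>" and f: "f \<in> observables 0"
  shows "(\<integral>x. average n f x \<partial>P) = (\<integral>x. f x \<partial>P)"
  by (induction n) (simp_all add: solution_step[OF P average_observable[OF f], symmetric])

lemma integral_average_mult:
  assumes P: "P \<in> solutions G T \<phi> \<mu>" and f: "f \<in> observables 0" and w: "w \<in> observables n"
  shows "(\<integral>x. average n f x * w x \<partial>P) = (\<integral>x. f x * w x \<partial>P)"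
proof -
  have "w \<in> observables 0"
    by (rule observables_antimono[OF _ w]) simp
  then have "(\<integral>x. f x * w x \<partial>P) = (\<integral>x. average n (\<lambda>x. f x * w x) x \<partial>P)"
    by (intro integral_average[OF P, symmetric] observables_mult f)
  also have "\<dots> = (\<integral>x. average n f x * w x \<partial>P)"
    by (intro Bochner_Integration.integral_cong average_mult[OF w]) (auto simp: solutionD(4)[OF P])
  finally show ?thesis ..
qed

lemma integral_density_real:
  fixes w f :: "(nat \<Rightarrow> 'a) \<Rightarrow> real"
  assumes P: "sets P = sets seq_space" and w: "w \<in> observables n"
    and nonneg: "\<And>x. x \<in> space seq_space \<Longrightarrow> 0 \<le> w x" and f: "f \<in> borel_measurable seq_space"
  shows "(\<integral>x. f x \<partial>density P w) = (\<integral>x. f x * w x \<partial>P)"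
  using f observablesD(1)[OF w] nonneg sets_eq_imp_space_eq[OF P]
  by (subst integral_real_density) (auto simp: P mult.commute cong: measurable_cong_sets)

text \<open>A density \<open>w\<close> that does not change when finitely many coordinates do is left unchanged by
  every redraw, so it can be pulled out of \<open>step k\<close> for each \<open>k\<close>.\<close>

lemma tilted_solution:
  assumes P: "P \<in> solutions G T \<phi> \<mu>" and w: "\<And>n. w \<in> observables n"
    and nonneg: "\<And>x. x \<in> space seq_space \<Longrightarrow> 0 \<le> w x" and total: "(\<integral>x. w x \<partial>P) = 1"
  shows "density P w \<in> solutions G T \<phi> \<mu>"
proof (rule solutionI_step)
  interpret prob_space P by (rule solutionD[OF P])
  note sets = solutionD(3)[OF P] and space = solutionD(4)[OF P]
  have int_density: "(\<integral>x. f x \<partial>density P w) = (\<integral>x. f x * w x \<partial>P)" if "f \<in> borel_measurable seq_space" for f :: "_ \<Rightarrow> real"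
    by (rule integral_density_real[OF sets w nonneg that])
  have wP: "w \<in> borel_measurable P"
    using observablesD(1)[OF w] by (simp add: sets cong: measurable_cong_sets)
  show "prob_space (density P w)"
  proof
    have "emeasure (density P w) (space (density P w)) = (\<integral>\<^sup>+x. w x \<partial>P)"
      using wP by (subst emeasure_density) (auto intro!: nn_integral_cong)
    also have "\<dots> = ennreal (\<integral>x. w x \<partial>P)"
      using integrable_observable[OF w solutionD(2,3)[OF P]] nonneg
      by (intro nn_integral_eq_integral) (auto simp: space)
    finally show "emeasure (density P w) (space (density P w)) = 1"
      by (simp add: total)
  qed
  show "sets (density P w) = sets seq_space"
    by (simp add: sets)
  fix k and f :: "(nat \<Rightarrow> 'a) \<Rightarrow> real" assume f: "f \<in> observables k"
  have "(\<integral>x. f x \<partial>density P w) = (\<integral>x. f x * w x \<partial>P)"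
    by (rule int_density[OF observablesD(1)[OF f]])
  also have "\<dots> = (\<integral>x. step k (\<lambda>x. f x * w x) x \<partial>P)"
    by (rule solution_step[OF P observables_mult[OF f w]])
  also have "\<dots> = (\<integral>x. step k f x * w x \<partial>P)"
    by (intro Bochner_Integration.integral_cong step_mult w) (auto simp: space)
  also have "\<dots> = (\<integral>x. step k f x \<partial>density P w)"
    by (rule int_density[symmetric, OF observablesD(1)[OF step_observable[OF f]]])
  finally show "(\<integral>x. f x \<partial>density P w) = (\<integral>x. step k f x \<partial>density P w)" .
qed

text \<open>For \<open>d = g - \<integral>g dP\<close> and \<open>c\<close> small, the densities \<open>1 \<plusminus> c d\<close> give two solutions
  with midpoint \<open>P\<close>, which must coincide. But their integrals of \<open>d\<close> are \<open>\<plusminus> c \<integral>d\<^sup>2 dP\<close>.\<close>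

lemma extreme_tail_variance_zero:
  assumes P: "P \<in> extreme_measures (solutions G T \<phi> \<mu>)" and g: "\<And>n. g \<in> observables n"
  shows "(\<integral>x. (g x - (\<integral>x. g x \<partial>P))^2 \<partial>P) = 0"
proof -
  have sol: "P \<in> solutions G T \<phi> \<mu>"
    using P by (simp add: extreme_measures_def)
  interpret prob_space P by (rule solutionD[OF sol])
  note sets = solutionD(3)[OF sol] and space = solutionD(4)[OF sol]
  note int = integrable_observable[OF _ solutionD(2,3)[OF sol]]
  define m where "m = (\<integral>x. g x \<partial>P)"
  define d where "d x = g x - m" for x
  have d: "d \<in> observables n" for n
    using observables_add[OF g observables_const[of "- m"], of n] by (simp add: d_def[abs_def])
  have d0: "(\<integral>x. d x \<partial>P) = 0"
    unfolding d_def m_def using int[OF g] by (simp add: prob_space)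
  obtain B where B: "\<And>x. x \<in> space seq_space \<Longrightarrow> \<bar>d x\<bar> \<le> B"
    using observablesD(2)[OF d[of 0]] by auto
  define c where "c = 1 / (\<bar>B\<bar> + 1)"
  have c: "0 < c" "\<And>x. x \<in> space seq_space \<Longrightarrow> \<bar>c * d x\<bar> \<le> 1"
  proof -
    show "0 < c" by (simp add: c_def)
    show "\<bar>c * d x\<bar> \<le> 1" if "x \<in> space seq_space" for x
      using B[OF that] by (simp add: c_def abs_mult)
  qed
  define w where "w s x = 1 + s * c * d x" for s x :: _
  have w: "w s \<in> observables n" for s n
    unfolding w_def[abs_def] by (intro observables_add observables_mult observables_const d)
  have w_nonneg: "0 \<le> w s x" if "x \<in> space seq_space" "s \<in> {-1, 1}" for s x
    using c(2)[OF that(1)] that(2) by (auto simp: w_def abs_le_iff)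
  have w_total: "(\<integral>x. w s x \<partial>P) = 1" for s
    unfolding w_def using int[OF d] d0 by (simp add: prob_space)
  have Q: "density P (w s) \<in> solutions G T \<phi> \<mu>" if "s \<in> {-1, 1}" for s
    using that by (intro tilted_solution sol w w_nonneg w_total)
  have Q_int: "(\<integral>x. f x \<partial>density P (w s)) = (\<integral>x. f x * w s x \<partial>P)"
    if "s \<in> {-1, 1}" "f \<in> borel_measurable seq_space" for s and f :: "_ \<Rightarrow> real"
    by (rule integral_density_real[OF sets w w_nonneg that(2)]) (use that in auto)
  have "density P (w 1) = density P (w (-1))"
  proof -
    have "measure P A = (1/2) * measure (density P (w 1)) A + (1 - 1/2) * measure (density P (w (-1))) A"
      if A: "A \<in> sets P" for A
    proof -
      have ind: "(indicator A :: _ \<Rightarrow> real) \<in> observables 0"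
        using A by (auto simp: observables_0 sets indicator_def intro!: exI[of _ 1])
      have "measure (density P (w s)) A = (\<integral>x. indicator A x * w s x \<partial>P)" if "s \<in> {-1, 1}" for s
        using Q_int[OF that observablesD(1)[OF ind]] A sets.sets_into_space[OF A] by (simp add: Int_absorb2)
      then have "(1/2) * measure (density P (w 1)) A + (1 - 1/2) * measure (density P (w (-1))) A =
          (1/2) * (\<integral>x. indicator A x * w 1 x + indicator A x * w (-1) x \<partial>P)"
        using int[OF observables_mult[OF ind w]] by simp
      also have "(\<integral>x. indicator A x * w 1 x + indicator A x * w (-1) x \<partial>P) = (\<integral>x. 2 * indicator A x \<partial>P)"
        by (intro Bochner_Integration.integral_cong) (auto simp: w_def algebra_simps)
      also have "\<dots> = 2 * measure P A"
        using sets.sets_into_space[OF A] by (simp add: Int_absorb2)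
      finally show ?thesis by simp
    qed
    moreover have "(1/2 :: real) \<in> {0<..<1}" by simp
    ultimately show ?thesis
      using P Q[of 1] Q[of "-1"] unfolding extreme_measures_def by blast
  qed
  then have "(\<integral>x. d x * w 1 x \<partial>P) = (\<integral>x. d x * w (-1) x \<partial>P)"
    using Q_int[of 1 d] Q_int[of "-1" d] observablesD(1)[OF d] by simp
  moreover have "(\<integral>x. d x * w s x \<partial>P) = s * c * (\<integral>x. (d x)\<^sup>2 \<partial>P)" for s
  proof -
    have "(\<integral>x. d x * w s x \<partial>P) = (\<integral>x. d x + s * c * (d x * d x) \<partial>P)"
      by (intro Bochner_Integration.integral_cong) (auto simp: w_def algebra_simps)
    also have "\<dots> = s * c * (\<integral>x. d x * d x \<partial>P)"
      using int[OF d] int[OF observables_mult[OF d d]] d0 by simp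
    finally show ?thesis by (simp add: power2_eq_square)
  qed
  ultimately show ?thesis
    using c(1) by (simp add: d_def m_def)
qed

text \<open>The increments of \<open>average n f\<close> over disjoint ranges of \<open>n\<close> are orthogonal, so the
  second moments \<open>a n\<close> decrease to a limit \<open>L\<close> and the averages are Cauchy in mean square. Along a
  sufficiently sparse sequence of indices they converge almost surely to some \<open>g\<close> that depends on the
  tail only, hence is constant by \<open>extreme_tail_variance_zero\<close>. This identifies \<open>L\<close> as the square
  of the mean, and convergence along the full sequence follows from monotonicity of \<open>a\<close>.\<close>

lemma extreme_average_variance_tendsto_0:
  assumes P: "P \<in> extreme_measures (solutions G T \<phi> \<mu>)" and f: "f \<in> observables 0"
  shows "(\<lambda>n. \<integral>x. (average n f x - (\<integral>x. f x \<partial>P))^2 \<partial>P) \<longlonglongrightarrow> 0"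
proof -
  have sol: "P \<in> solutions G T \<phi> \<mu>"
    using P by (simp add: extreme_measures_def)
  interpret prob_space P by (rule solutionD[OF sol])
  note sets = solutionD(3)[OF sol] and space = solutionD(4)[OF sol]
  note int = integrable_observable[OF _ solutionD(2,3)[OF sol]]
  note A = average_observable[OF f]
  have A_mono: "average m f \<in> observables n" if "n \<le> m" for n m
    by (rule observables_antimono[OF that A])
  define m where "m = (\<integral>x. f x \<partial>P)"
  define a where "a n = (\<integral>x. average n f x * average n f x \<partial>P)" for n
  have A_int: "integrable P (average n f)" for n
    by (rule int[OF A])
  have AA_int: "integrable P (\<lambda>x. average n f x * average k f x)" for n k
    by (rule int[OF observables_mult[OF A_mono[of 0] A_mono[of 0]]]) simp_all
  have ortho: "(\<integral>x. (average n f x - average k f x)\<^sup>2 \<partial>P) = a n - a k" if "n \<le> k" for n k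
  proof -
    have "(\<integral>x. average n f x * average k f x \<partial>P) = a k"
      using integral_average_mult[OF sol f A_mono[OF that]] integral_average_mult[OF sol f A[of k]]
      by (simp add: a_def)
    moreover have "(\<integral>x. (average n f x - average k f x)\<^sup>2 \<partial>P) =
        (\<integral>x. average n f x * average n f x - 2 * (average n f x * average k f x) + average k f x * average k f x \<partial>P)"
      by (intro Bochner_Integration.integral_cong) (auto simp: power2_eq_square algebra_simps)
    ultimately show ?thesis
      using AA_int by (simp add: a_def)
  qed
  have var: "(\<integral>x. (average n f x - m)\<^sup>2 \<partial>P) = a n - m\<^sup>2" for n
  proof -
    have "(\<integral>x. (average n f x - m)\<^sup>2 \<partial>P) =
        (\<integral>x. average n f x * average n f x - 2 * m * average n f x + m\<^sup>2 \<partial>P)"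
      by (intro Bochner_Integration.integral_cong) (auto simp: power2_eq_square algebra_simps)
    also have "\<dots> = a n - 2 * m * (\<integral>x. average n f x \<partial>P) + m\<^sup>2"
      using AA_int A_int by (simp add: a_def prob_space)
    finally show ?thesis
      by (simp add: integral_average[OF sol f] m_def power2_eq_square)
  qed
  have "decseq a"
  proof (rule decseq_SucI)
    fix n
    have "0 \<le> (\<integral>x. (average n f x - average (Suc n) f x)\<^sup>2 \<partial>P)"
      by simp
    then show "a (Suc n) \<le> a n"
      using ortho[of n "Suc n"] by (simp del: average.simps)
  qed
  moreover have "0 \<le> a n" for n
    unfolding a_def by simp
  ultimately obtain L where L: "a \<longlonglongrightarrow> L" "\<And>n. L \<le> a n"
    using decseq_convergent by metis
  have "\<exists>N. \<forall>n\<ge>N. a n - L \<le> (1/4)^j" for j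
  proof -
    have "eventually (\<lambda>n. a n < L + (1/4)^j) sequentially"
      using L(1) by (rule order_tendstoD) simp
    then show ?thesis
      unfolding eventually_sequentially by (metis add.commute diff_le_eq less_imp_le)
  qed
  then obtain N where N: "\<And>j n. N j \<le> n \<Longrightarrow> a n - L \<le> (1/4)^j"
    by metis
  \<comment> \<open>The sum makes \<open>r\<close> monotone and the summand \<open>j\<close> makes it unbounded, while \<open>r j\<close> stays above \<open>N j\<close>.\<close>
  define r where "r j = j + (\<Sum>i\<le>j. N i)" for j
  have r: "N j \<le> r j" "j \<le> r j" "r j \<le> r (Suc j)" for j
    using member_le_sum[of j "{..j}" N] by (auto simp: r_def)
  define u where "u j = average (r j) f" for j
  obtain B where B: "\<And>x. x \<in> space seq_space \<Longrightarrow> \<bar>f x - 0\<bar> \<le> B"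
    using observablesD(2)[OF f] by auto
  have u_bound: "\<bar>u j x\<bar> \<le> B" if "x \<in> space seq_space" for j x
    using average_close[OF f observables_const[of 0] B that, of "r j"] by (simp add: u_def average_const)
  have u: "u j \<in> observables 0" for j
    unfolding u_def by (rule A_mono) simp
  have u_meas: "u j \<in> borel_measurable P" for j
    using observablesD(1)[OF u] by (simp add: sets cong: measurable_cong_sets)
  have diff_int: "integrable P (\<lambda>x. \<bar>u (Suc j) x - u j x\<bar>)"
      "integrable P (\<lambda>x. (u j x - u (Suc j) x)\<^sup>2)" for j
    using A_int AA_int by (auto simp: u_def power2_eq_square algebra_simps)
  have diff: "(\<integral>x. \<bar>u (Suc j) x - u j x\<bar> \<partial>P) \<le> (1/2)^j" for j
  proof -
    \<comment> \<open>The inequality of arithmetic and geometric means, weighted so that both terms become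
      \<open>(1/2)^j\<close> once the second moment of \<open>y\<close> is bounded by \<open>(1/4)^j\<close>.\<close>
    have "\<bar>y\<bar> \<le> (2^j * y\<^sup>2 + (1/2)^j) / 2" for y :: real
    proof -
      have "0 \<le> 2^j * (\<bar>y\<bar> - (1/2)^j)\<^sup>2"
        by simp
      also have "\<dots> = 2^j * y\<^sup>2 - 2 * \<bar>y\<bar> + (1/2)^j"
        by (simp add: power2_eq_square field_simps power_divide)
      finally show ?thesis by simp
    qed
    from this[of "u j _ - u (Suc j) _"] have "(\<integral>x. \<bar>u (Suc j) x - u j x\<bar> \<partial>P) \<le>
        (\<integral>x. (2^j * (u j x - u (Suc j) x)\<^sup>2 + (1/2)^j) / 2 \<partial>P)"
      using diff_int by (intro integral_mono) (auto simp: abs_minus_commute)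
    also have "\<dots> = (2^j * (a (r j) - a (r (Suc j))) + (1/2)^j) / 2"
      using diff_int by (simp add: ortho[OF r(3)] u_def[symmetric] prob_space ortho[OF r(3), folded u_def])
    also have "\<dots> \<le> (2^j * (1/4)^j + (1/2)^j) / 2"
      using N[OF r(1)[of j]] L(2)[of "r (Suc j)"] by (simp add: divide_right_mono)
    also have "\<dots> = (1/2)^j"
      by (simp add: power_mult_distrib[symmetric])
    finally show ?thesis .
  qed
  have conv: "AE x in P. convergent (\<lambda>j. u j x)"
  proof (rule AE_convergent_if_summable_increments)
    show "integrable P (u j)" for j
      by (simp add: u_def A_int)
    show "summable (\<lambda>j. \<integral>x. \<bar>u (Suc j) x - u j x\<bar> \<partial>P)"
      by (rule summable_comparison_test'[of "\<lambda>j. (1/2) ^ j" 0]) (use diff in auto)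
  qed
  \<comment> \<open>Where the sequence diverges, \<open>lim\<close> is an unspecified value; clamping keeps \<open>g\<close> bounded there and
    does not affect the genuine limits.\<close>
  define g where "g x = max (- B) (min B (lim (\<lambda>j. u j x)))" for x
  have g: "g \<in> observables n" for n
  proof -
    have "g \<in> borel_measurable seq_space"
      unfolding g_def using observablesD(1)[OF u] by measurable
    moreover have "\<bar>g x\<bar> \<le> \<bar>B\<bar>" for x
      by (auto simp: g_def)
    moreover have "g (forget n x) = g x" if x: "x \<in> space seq_space" for x
    proof -
      have "eventually (\<lambda>j. u j (forget n x) = u j x) sequentially"
        unfolding eventually_sequentially
      proof (intro exI allI impI)
        fix j assume "n \<le> j"
        then have "n \<le> r j" using r(2)[of j] by simp
        then show "u j (forget n x) = u j x"
          unfolding u_def by (intro observablesD(3)[OF A_mono x])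
      qed
      then show ?thesis
        unfolding g_def lim_def by (simp cong: tendsto_cong)
    qed
    ultimately show ?thesis
      by (auto simp: observables_def)
  qed
  have g_lim: "AE x in P. (\<lambda>j. u j x) \<longlonglongrightarrow> g x"
    using conv AE_space
  proof eventually_elim
    case (elim x)
    then have lim: "(\<lambda>j. u j x) \<longlonglongrightarrow> lim (\<lambda>j. u j x)"
      by (simp add: convergent_LIMSEQ_iff)
    have "u j x \<le> B" "- B \<le> u j x" for j
      using u_bound[of x j] elim by (auto simp: space abs_le_iff)
    then have "lim (\<lambda>j. u j x) \<le> B" "- B \<le> lim (\<lambda>j. u j x)"
      using lim by (auto intro: LIMSEQ_le_const LIMSEQ_le_const2)
    then have "g x = lim (\<lambda>j. u j x)"
      by (simp add: g_def)
    then show ?case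
      using lim by simp
  qed
  have g_meas: "g \<in> borel_measurable P"
    using observablesD(1)[OF g] by (simp add: sets cong: measurable_cong_sets)
  have "(\<lambda>j. \<integral>x. u j x \<partial>P) \<longlonglongrightarrow> (\<integral>x. g x \<partial>P)"
    by (rule integral_dominated_convergence[where w="\<lambda>_. B"])
      (use g_lim u_bound in \<open>auto simp: space u_meas g_meas intro!: AE_I2\<close>)
  moreover have "(\<integral>x. u j x \<partial>P) = m" for j
    by (simp add: u_def m_def integral_average[OF sol f])
  ultimately have g_m: "(\<integral>x. g x \<partial>P) = m"
    by (simp add: LIMSEQ_const_iff)
  have "(\<lambda>j. \<integral>x. (u j x - m)\<^sup>2 \<partial>P) \<longlonglongrightarrow> (\<integral>x. (g x - m)\<^sup>2 \<partial>P)"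
  proof (rule integral_dominated_convergence[where w="\<lambda>_. (B + \<bar>m\<bar>)\<^sup>2"])
    show "AE x in P. (\<lambda>j. (u j x - m)\<^sup>2) \<longlonglongrightarrow> (g x - m)\<^sup>2"
      using g_lim by eventually_elim (intro tendsto_intros)
    show "AE x in P. norm ((u j x - m)\<^sup>2) \<le> (B + \<bar>m\<bar>)\<^sup>2" for j
    proof (rule AE_I2)
      fix x assume "x \<in> space P"
      then have "\<bar>u j x - m\<bar> \<le> B + \<bar>m\<bar>"
        using u_bound[of x j] by (simp add: space)
      then show "norm ((u j x - m)\<^sup>2) \<le> (B + \<bar>m\<bar>)\<^sup>2"
        by (simp add: abs_le_square_iff[symmetric])
    qed
  qed (use u_meas g_meas in auto)
  then have "(\<lambda>j. a (r j) - m\<^sup>2) \<longlonglongrightarrow> 0"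
    using extreme_tail_variance_zero[OF P g] by (simp add: g_m u_def var)
  moreover have "filterlim r at_top sequentially"
    by (rule filterlim_at_top_mono[OF filterlim_ident]) (simp add: r(2))
  then have "(\<lambda>j. a (r j) - m\<^sup>2) \<longlonglongrightarrow> L - m\<^sup>2"
    by (intro tendsto_diff filterlim_compose[OF L(1)] tendsto_const)
  ultimately have "L = m\<^sup>2"
    using LIMSEQ_unique by fastforce
  then have "(\<lambda>n. a n - m\<^sup>2) \<longlonglongrightarrow> 0"
    using tendsto_diff[OF L(1) tendsto_const[of "m\<^sup>2"]] by simp
  then show ?thesis
    unfolding m_def[symmetric] var .
qed

text \<open>The sum over \<open>f\<close> of the squared deviations has expectation below \<open>\<epsilon>\<^sup>2\<close> for large \<open>n\<close>, so it is
  below \<open>\<epsilon>\<^sup>2\<close> at some point.\<close>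

lemma extreme_eventually_average_close:
  assumes P: "P \<in> extreme_measures (solutions G T \<phi> \<mu>)"
    and F: "finite F" "F \<subseteq> observables 0" and \<epsilon>: "0 < \<epsilon>"
  shows "\<forall>\<^sub>F n in sequentially. \<exists>x\<in>space seq_space. \<forall>f\<in>F. \<bar>average n f x - (\<integral>x. f x \<partial>P)\<bar> \<le> \<epsilon>"
proof -
  have sol: "P \<in> solutions G T \<phi> \<mu>"
    using P by (simp add: extreme_measures_def)
  interpret prob_space P by (rule solutionD[OF sol])
  note space = solutionD(4)[OF sol]
  note int = integrable_observable[OF _ solutionD(2,3)[OF sol]]
  let ?d = "\<lambda>n f x. average n f x - (\<integral>x. f x \<partial>P)"
  have "(\<lambda>n. \<Sum>f\<in>F. \<integral>x. (?d n f x)\<^sup>2 \<partial>P) \<longlonglongrightarrow> (\<Sum>f\<in>F. 0)"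
    using F by (intro tendsto_sum extreme_average_variance_tendsto_0[OF P]) auto
  then have "\<forall>\<^sub>F n in sequentially. (\<Sum>f\<in>F. \<integral>x. (?d n f x)\<^sup>2 \<partial>P) < \<epsilon>\<^sup>2"
    using \<epsilon> by (intro order_tendstoD(2)) auto
  then show ?thesis
  proof eventually_elim
    case (elim n)
    have d_int: "integrable P (\<lambda>x. (?d n f x)\<^sup>2)" if "f \<in> F" for f
    proof -
      have "?d n f \<in> observables n"
        using observables_add[OF average_observable observables_const[of "- (\<integral>x. f x \<partial>P)" n], of f] F that by auto
      from int[OF observables_mult[OF this this]] show ?thesis
        by (simp add: power2_eq_square)
    qed
    show ?case
    proof (rule ccontr)
      assume neg: "\<not> (\<exists>x\<in>space seq_space. \<forall>f\<in>F. \<bar>?d n f x\<bar> \<le> \<epsilon>)"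
      have "\<epsilon>\<^sup>2 \<le> (\<Sum>f\<in>F. (?d n f x)\<^sup>2)" if x: "x \<in> space P" for x
      proof -
        obtain f where f: "f \<in> F" "\<epsilon> < \<bar>?d n f x\<bar>"
          using neg x unfolding space by (meson not_le)
        then have "\<epsilon>\<^sup>2 \<le> \<bar>?d n f x\<bar>\<^sup>2"
          using \<epsilon> by (intro power_mono) auto
        also have "\<dots> \<le> (\<Sum>f\<in>F. (?d n f x)\<^sup>2)"
          using member_le_sum[OF f(1), of "\<lambda>f. (?d n f x)\<^sup>2"] F(1) by simp
        finally show ?thesis .
      qed
      then have "\<epsilon>\<^sup>2 \<le> (\<integral>x. (\<Sum>f\<in>F. (?d n f x)\<^sup>2) \<partial>P)"
        using d_int by (intro integral_ge_const) auto
      also have "\<dots> = (\<Sum>f\<in>F. \<integral>x. (?d n f x)\<^sup>2 \<partial>P)"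
        using d_int by (rule Bochner_Integration.integral_sum)
      finally show False
        using elim by simp
    qed
  qed
qed

section \<open>Translations\<close>

definition act :: "(nat \<Rightarrow> 'a) \<Rightarrow> (nat \<Rightarrow> 'a) \<Rightarrow> nat \<Rightarrow> 'a" where
  "act h x = (\<lambda>k. h k \<otimes>\<^bsub>G k\<^esub> x k)"

lemma act_closed: "h \<in> space seq_space \<Longrightarrow> x \<in> space seq_space \<Longrightarrow> act h x \<in> space seq_space"
  by (simp add: space_seq act_def mult_closed)

text \<open>Translations multiply on the left and the noise multiplies on the right, so the two commute
  as soon as \<open>\<phi> k\<close> carries \<open>h (Suc k)\<close> to \<open>h k\<close>.\<close>

lemma redraw_act:
  assumes "h \<in> space seq_space" "x \<in> space seq_space" "z \<in> carrier (G k)"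
    and compat: "h k = \<phi> k (h (Suc k))"
  shows "redraw k (act h x) z = act h (redraw k x z)"
proof -
  have "\<phi> k (h (Suc k) \<otimes>\<^bsub>G (Suc k)\<^esub> x (Suc k)) \<otimes>\<^bsub>G k\<^esub> z = h k \<otimes>\<^bsub>G k\<^esub> (\<phi> k (x (Suc k)) \<otimes>\<^bsub>G k\<^esub> z)"
    using assms hom_mult[OF hom] group[of k] compat
    by (simp add: space_seq hom_closed group.is_monoid monoid.m_assoc)
  then show ?thesis
    by (simp add: redraw_def act_def fun_eq_iff)
qed

lemma average_act:
  assumes h: "h \<in> space seq_space" and x: "x \<in> space seq_space"
    and compat: "\<And>k. k < n \<Longrightarrow> h k = \<phi> k (h (Suc k))"
  shows "average n (\<lambda>x. f (act h x)) x = average n f (act h x)"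
  using x compat
proof (induction n arbitrary: x)
  case (Suc n)
  then have "average (Suc n) (\<lambda>x. f (act h x)) x = step n (\<lambda>x. average n f (act h x)) x"
    by (auto intro: step_cong)
  also have "\<dots> = average (Suc n) f (act h x)"
    using Suc.prems unfolding average.simps step_def
    by (intro Bochner_Integration.integral_cong) (simp_all add: redraw_act h space_noise)
  finally show ?case .
qed simp

lemma ex_compatible_prefix:
  assumes "y \<in> space seq_space"
  shows "\<exists>h\<in>space seq_space. (\<forall>k<n. h k = \<phi> k (h (Suc k))) \<and> (\<forall>k\<ge>n. h k = y k)"
  using assms
proof (induction n arbitrary: y)
  case 0
  then show ?case by auto
next
  case (Suc n)
  let ?y = "y(n := \<phi> n (y (Suc n)))"
  have "?y \<in> space seq_space"
    using Suc.prems by (simp add: space_seq hom_closed)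
  from Suc.IH[OF this] obtain h where h: "h \<in> space seq_space" "\<And>k. k < n \<Longrightarrow> h k = \<phi> k (h (Suc k))"
      "\<And>k. n \<le> k \<Longrightarrow> h k = ?y k"
    by auto
  show ?case
  proof (intro bexI[of _ h] conjI allI impI)
    show "h k = \<phi> k (h (Suc k))" if "k < Suc n" for k
      using h(2)[of k] h(3)[of k] h(3)[of "Suc k"] that by (cases "k = n") auto
    show "h k = y k" if "Suc n \<le> k" for k
      using h(3)[of k] that by simp
  qed (rule h)
qed

lemma compact_seq: "compact_space seq_top"
  using compact_second_countable_group.compact_space[OF compact_group]
  by (simp add: compact_space_product_topology)

lemma Hausdorff_seq: "Hausdorff_space seq_top"
  using compact_second_countable_group.Hausdorff_space[OF compact_group]
  by (simp add: Hausdorff_space_product_topology)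

lemma continuous_act: "continuous_map (prod_topology seq_top seq_top) seq_top (\<lambda>p. act (fst p) (snd p))"
  unfolding continuous_map_componentwise_UNIV act_def
proof
  fix k
  have mult: "continuous_map (prod_topology (T k) (T k)) (T k) (\<lambda>(x, y). x \<otimes>\<^bsub>G k\<^esub> y)"
    using topological_group.continuous_map_mult[of "G k" "T k"] compact_group[of k]
    by (simp add: compact_second_countable_group_def)
  have proj: "continuous_map seq_top (T k) (\<lambda>x. x k)"
    by (rule continuous_map_product_projection) simp
  have "continuous_map (prod_topology seq_top seq_top) (prod_topology (T k) (T k)) (\<lambda>p. (fst p k, snd p k))"
    using continuous_map_compose[OF continuous_map_fst proj] continuous_map_compose[OF continuous_map_snd proj]
    by (intro continuous_map_pairedI) (simp_all add: o_def)
  from continuous_map_compose[OF this mult]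
  show "continuous_map (prod_topology seq_top seq_top) (T k) (\<lambda>x. fst x k \<otimes>\<^bsub>G k\<^esub> snd x k)"
    by (simp add: o_def)
qed

lemma continuous_act_right:
  assumes "h \<in> space seq_space"
  shows "continuous_map seq_top seq_top (act h)"
proof -
  have "continuous_map seq_top (prod_topology seq_top seq_top) (\<lambda>x. (h, x))"
    using assms by (intro continuous_map_pairedI) (simp_all add: topspace_seq del: topspace_product_topology)
  from continuous_map_compose[OF this continuous_act] show ?thesis
    by (simp add: o_def)
qed

lemma continuous_observable:
  assumes f: "continuous_map seq_top euclideanreal f"
  shows "f \<in> observables 0"
proof -
  have "f \<in> borel_measurable (borel_of seq_top)"
    by (rule continuous_map_borel_measurable[OF f])
  moreover have "compactin euclideanreal (f ` topspace seq_top)"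
    using compact_seq by (intro image_compactin[OF _ f]) (simp add: compact_space_def)
  then have "bounded (f ` space seq_space)"
    unfolding topspace_seq by (simp add: compact_imp_bounded)
  ultimately show ?thesis
    by (auto simp: observables_0 bounded_iff sets_seq cong: measurable_cong_sets)
qed

lemma continuous_translate:
  assumes f: "continuous_map seq_top euclideanreal f" and h: "h \<in> space seq_space"
  shows "continuous_map seq_top euclideanreal (\<lambda>x. f (act h x))"
  using continuous_map_compose[OF continuous_act_right[OF h] f] by (simp add: o_def)

text \<open>The tube lemma: the set of pairs \<open>(h, x)\<close> satisfying the estimate strictly is open and
  contains the compact slice over \<open>j\<close>.\<close>

lemma act_equicontinuous:
  assumes f: "continuous_map seq_top euclideanreal f" and j: "j \<in> space seq_space" and \<epsilon>: "0 < \<epsilon>"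
  shows "\<exists>W. openin seq_top W \<and> j \<in> W \<and>
    (\<forall>h\<in>W. \<forall>x\<in>space seq_space. \<bar>f (act h x) - f (act j x)\<bar> \<le> \<epsilon>)"
proof -
  let ?X = "prod_topology seq_top seq_top"
  define F where "F p = f (act (fst p) (snd p)) - f (act j (snd p))" for p
  have "continuous_map ?X euclideanreal F"
    unfolding F_def
    using continuous_map_compose[OF continuous_act f]
      continuous_map_compose[OF continuous_map_snd continuous_translate[OF f j]]
    by (intro continuous_map_diff) (simp_all add: o_def)
  then have op: "openin ?X {p \<in> topspace ?X. F p \<in> {- \<epsilon> <..< \<epsilon>}}"
    by (rule openin_continuous_map_preimage) simp
  have compact: "compactin seq_top {j}" "compactin seq_top (topspace seq_top)"
    using j compact_seq by (simp_all add: topspace_seq compact_space_def del: topspace_product_topology)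
  have sub: "{j} \<times> topspace seq_top \<subseteq> {p \<in> topspace ?X. F p \<in> {- \<epsilon> <..< \<epsilon>}}"
    using j \<epsilon> by (auto simp: F_def topspace_seq simp del: topspace_product_topology)
  obtain U V where UV: "openin seq_top U" "openin seq_top V" "{j} \<subseteq> U" "topspace seq_top \<subseteq> V"
      "U \<times> V \<subseteq> {p \<in> topspace ?X. F p \<in> {- \<epsilon> <..< \<epsilon>}}"
    by (rule Wallace_theorem_prod_topology[OF compact op sub], rule that)
  have "\<bar>f (act h x) - f (act j x)\<bar> \<le> \<epsilon>" if "h \<in> U" "x \<in> space seq_space" for h x
  proof -
    have "x \<in> V"
      using UV(4) that(2) by (auto simp: topspace_seq simp del: topspace_product_topology)
    then have "(h, x) \<in> {p \<in> topspace ?X. F p \<in> {- \<epsilon> <..< \<epsilon>}}"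
      using UV(5) that(1) by blast
    then show ?thesis
      by (auto simp: F_def)
  qed
  then show ?thesis
    using UV(1,3) by (intro exI[of _ U]) auto
qed

lemma act_totally_bounded:
  assumes f: "continuous_map seq_top euclideanreal f" and \<epsilon>: "0 < \<epsilon>"
  shows "\<exists>J. finite J \<and> J \<subseteq> space seq_space \<and>
    (\<forall>h\<in>space seq_space. \<exists>j\<in>J. \<forall>x\<in>space seq_space. \<bar>f (act h x) - f (act j x)\<bar> \<le> \<epsilon>)"
proof -
  obtain W where W: "\<And>j. j \<in> space seq_space \<Longrightarrow> openin seq_top (W j)"
      "\<And>j. j \<in> space seq_space \<Longrightarrow> j \<in> W j"
      "\<And>j h x. j \<in> space seq_space \<Longrightarrow> h \<in> W j \<Longrightarrow> x \<in> space seq_space \<Longrightarrow> \<bar>f (act h x) - f (act j x)\<bar> \<le> \<epsilon>"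
    using act_equicontinuous[OF f _ \<epsilon>] by metis
  have "\<exists>\<F>. finite \<F> \<and> \<F> \<subseteq> W ` space seq_space \<and> topspace seq_top \<subseteq> \<Union>\<F>"
  proof (rule compact_space_alt[THEN iffD1, OF compact_seq, rule_format])
    show "(\<forall>U\<in>W ` space seq_space. openin seq_top U) \<and> topspace seq_top \<subseteq> \<Union> (W ` space seq_space)"
      unfolding topspace_seq using W(1,2) by auto
  qed
  then obtain J where J: "finite J" "J \<subseteq> space seq_space" "space seq_space \<subseteq> \<Union> (W ` J)"
    unfolding topspace_seq using finite_subset_image by metis
  show ?thesis
  proof (intro exI[of _ J] conjI ballI J)
    fix h assume "h \<in> space seq_space"
    then obtain j where "j \<in> J" "h \<in> W j"
      using J(3) by auto
    then show "\<exists>j\<in>J. \<forall>x\<in>space seq_space. \<bar>f (act h x) - f (act j x)\<bar> \<le> \<epsilon>"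
      using J(2) by (intro bexI[of _ j] ballI W(3)) auto
  qed
qed

text \<open>Choose a point \<open>x'\<close> at which the averages of the functions in \<open>F\<close> are close to their
  integrals under \<open>P'\<close>, and a point \<open>x''\<close> that does the same for \<open>P''\<close> and finitely many translates
  that approximate all the others. The sequence \<open>h\<close> that carries the tail of \<open>x''\<close> to that of \<open>x'\<close>
  then equates the averages at the two points.\<close>

lemma ex_approximate_translation:
  assumes P': "P' \<in> extreme_measures (solutions G T \<phi> \<mu>)"
    and P'': "P'' \<in> extreme_measures (solutions G T \<phi> \<mu>)"
    and F: "finite F" "\<And>f. f \<in> F \<Longrightarrow> continuous_map seq_top euclideanreal f" and \<epsilon>: "0 < \<epsilon>"
  shows "\<exists>h\<in>space seq_space. (\<forall>k<n. h k = \<phi> k (h (Suc k))) \<and>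
    (\<forall>f\<in>F. \<bar>(\<integral>x. f x \<partial>P') - (\<integral>x. f (act h x) \<partial>P'')\<bar> \<le> \<epsilon>)"
proof -
  \<comment> \<open>Four errors add up: one for each of the points \<open>x'\<close> and \<open>x''\<close>, and two for replacing \<open>h\<close> by an
    element of the net, once inside the average and once inside the integral.\<close>
  define \<delta> where "\<delta> = \<epsilon> / 4"
  have \<delta>: "0 < \<delta>" using \<epsilon> by (simp add: \<delta>_def)
  have sol: "P'' \<in> solutions G T \<phi> \<mu>"
    using P'' by (simp add: extreme_measures_def)
  have "\<forall>f\<in>F. \<exists>J. finite J \<and> J \<subseteq> space seq_space \<and>
    (\<forall>h\<in>space seq_space. \<exists>j\<in>J. \<forall>x\<in>space seq_space. \<bar>f (act h x) - f (act j x)\<bar> \<le> \<delta>)"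
    using act_totally_bounded[OF F(2) \<delta>] by blast
  from bchoice[OF this] obtain J where J': "\<forall>f\<in>F. finite (J f) \<and> J f \<subseteq> space seq_space \<and>
    (\<forall>h\<in>space seq_space. \<exists>j\<in>J f. \<forall>x\<in>space seq_space. \<bar>f (act h x) - f (act j x)\<bar> \<le> \<delta>)"
    by (rule exE)
  then have J: "\<And>f. f \<in> F \<Longrightarrow> finite (J f)" "\<And>f. f \<in> F \<Longrightarrow> J f \<subseteq> space seq_space"
      "\<And>f h. f \<in> F \<Longrightarrow> h \<in> space seq_space \<Longrightarrow>
        \<exists>j\<in>J f. \<forall>x\<in>space seq_space. \<bar>f (act h x) - f (act j x)\<bar> \<le> \<delta>"
    by simp_all
  define F'' where "F'' = (\<Union>f\<in>F. (\<lambda>j x. f (act j x)) ` J f)"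
  have F_obs: "F \<subseteq> observables 0"
    using F(2) continuous_observable by auto
  have obs: "(\<lambda>x. f (act h x)) \<in> observables 0" if "f \<in> F" "h \<in> space seq_space" for f h
    by (intro continuous_observable continuous_translate F that)
  have F'': "finite F''" "F'' \<subseteq> observables 0"
  proof -
    show "finite F''"
      unfolding F''_def using F(1) J(1) by auto
    show "F'' \<subseteq> observables 0"
    proof
      fix g assume "g \<in> F''"
      then obtain f j where "f \<in> F" "j \<in> J f" "g = (\<lambda>x. f (act j x))"
        by (auto simp: F''_def)
      then show "g \<in> observables 0"
        using obs[of f j] J(2)[of f] by auto
    qed
  qed
  have "\<forall>\<^sub>F m in sequentially. n \<le> m \<and>
      (\<exists>x\<in>space seq_space. \<forall>f\<in>F. \<bar>average m f x - (\<integral>x. f x \<partial>P')\<bar> \<le> \<delta>) \<and>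
      (\<exists>x\<in>space seq_space. \<forall>f\<in>F''. \<bar>average m f x - (\<integral>x. f x \<partial>P'')\<bar> \<le> \<delta>)"
    by (intro eventually_conj eventually_ge_at_top
        extreme_eventually_average_close[OF P' F(1) F_obs \<delta>]
        extreme_eventually_average_close[OF P'' F'' \<delta>])
  then obtain m where "n \<le> m \<and>
      (\<exists>x\<in>space seq_space. \<forall>f\<in>F. \<bar>average m f x - (\<integral>x. f x \<partial>P')\<bar> \<le> \<delta>) \<and>
      (\<exists>x\<in>space seq_space. \<forall>f\<in>F''. \<bar>average m f x - (\<integral>x. f x \<partial>P'')\<bar> \<le> \<delta>)"
    using eventually_happens'[OF sequentially_bot] by blast
  then obtain x' x'' where m: "n \<le> m" and x: "x' \<in> space seq_space" "x'' \<in> space seq_space"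
    and x': "\<And>f. f \<in> F \<Longrightarrow> \<bar>average m f x' - (\<integral>x. f x \<partial>P')\<bar> \<le> \<delta>"
    and x'': "\<And>f. f \<in> F'' \<Longrightarrow> \<bar>average m f x'' - (\<integral>x. f x \<partial>P'')\<bar> \<le> \<delta>"
    by blast
  have "(\<lambda>k. x' k \<otimes>\<^bsub>G k\<^esub> inv\<^bsub>G k\<^esub> x'' k) \<in> space seq_space"
    using x by (simp add: space_seq mult_closed inv_closed)
  from ex_compatible_prefix[OF this, of m] obtain h where h: "h \<in> space seq_space"
      "\<And>k. k < m \<Longrightarrow> h k = \<phi> k (h (Suc k))"
      "\<And>k. m \<le> k \<Longrightarrow> h k = x' k \<otimes>\<^bsub>G k\<^esub> inv\<^bsub>G k\<^esub> x'' k"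
    by auto
  have "x' k \<otimes>\<^bsub>G k\<^esub> inv\<^bsub>G k\<^esub> x'' k \<otimes>\<^bsub>G k\<^esub> x'' k = x' k" for k
    using x group[of k]
    by (simp add: space_seq group.inv_solve_right' inv_closed group.is_monoid monoid.m_assoc group.l_inv monoid.r_one)
  then have forget: "forget m (act h x'') = forget m x'"
    using h(3) by (auto simp: forget_def act_def fun_eq_iff)
  show ?thesis
  proof (intro bexI[of _ h] conjI allI impI ballI h(1))
    show "h k = \<phi> k (h (Suc k))" if "k < n" for k
      by (rule h(2)) (use that m in simp)
    fix f assume f: "f \<in> F"
    then have f_obs: "f \<in> observables 0" using F_obs by auto
    obtain j where j: "j \<in> J f" "\<And>x. x \<in> space seq_space \<Longrightarrow> \<bar>f (act h x) - f (act j x)\<bar> \<le> \<delta>"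
      using J(3)[OF f h(1)] by auto
    have j_space: "j \<in> space seq_space" using J(2)[OF f] j(1) by auto
    have "average m f x' = average m f (act h x'')"
      using observablesD(3)[OF average_observable[OF f_obs]] x h(1) forget act_closed by metis
    also have "\<dots> = average m (\<lambda>x. f (act h x)) x''"
      by (rule average_act[symmetric, OF h(1) x(2) h(2)])
    finally have "average m f x' = average m (\<lambda>x. f (act h x)) x''" .
    moreover have "\<bar>average m (\<lambda>x. f (act h x)) x'' - average m (\<lambda>x. f (act j x)) x''\<bar> \<le> \<delta>"
      by (rule average_close[OF obs[OF f h(1)] obs[OF f j_space] j(2) x(2)])
    moreover have "\<bar>average m (\<lambda>x. f (act j x)) x'' - (\<integral>x. f (act j x) \<partial>P'')\<bar> \<le> \<delta>"
      by (rule x'') (use f j in \<open>auto simp: F''_def\<close>)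
    moreover have "\<bar>(\<integral>x. f (act h x) \<partial>P'') - (\<integral>x. f (act j x) \<partial>P'')\<bar> \<le> \<delta>"
      by (intro prob_space.integral_close integrable_observable[OF obs] solutionD[OF sol] f h(1) j_space j(2))
        (simp add: solutionD(4)[OF sol])
    ultimately show "\<bar>(\<integral>x. f x \<partial>P') - (\<integral>x. f (act h x) \<partial>P'')\<bar> \<le> \<epsilon>"
      using x'[OF f] unfolding \<delta>_def by linarith
  qed
qed

lemma closedin_translate_close:
  assumes f: "continuous_map seq_top euclideanreal f" and P: "prob_space P" "sets P = sets seq_space"
  shows "closedin seq_top {h \<in> space seq_space. \<bar>c - (\<integral>x. f (act h x) \<partial>P)\<bar> \<le> \<epsilon>}"
    (is "closedin _ ?D")
proof -
  have "openin seq_top (space seq_space - ?D)"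
  proof (subst openin_subopen, intro ballI)
    fix j assume j: "j \<in> space seq_space - ?D"
    define \<delta> where "\<delta> = (\<bar>c - (\<integral>x. f (act j x) \<partial>P)\<bar> - \<epsilon>) / 2"
    have \<delta>: "0 < \<delta>" using j by (auto simp: \<delta>_def)
    have "j \<in> space seq_space" using j by simp
    from act_equicontinuous[OF f this \<delta>] obtain W where W: "openin seq_top W" "j \<in> W"
        "\<And>h x. h \<in> W \<Longrightarrow> x \<in> space seq_space \<Longrightarrow> \<bar>f (act h x) - f (act j x)\<bar> \<le> \<delta>"
      by auto
    have "W \<subseteq> space seq_space - ?D"
    proof
      fix h assume h: "h \<in> W"
      then have hs: "h \<in> space seq_space"
        using openin_subset[OF W(1)] unfolding topspace_seq by auto
      have "\<bar>(\<integral>x. f (act h x) \<partial>P) - (\<integral>x. f (act j x) \<partial>P)\<bar> \<le> \<delta>"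
        using j hs W(3)[OF h] sets_eq_imp_space_eq[OF P(2)]
        by (intro prob_space.integral_close integrable_observable[where n=0] P continuous_observable
            continuous_translate f) auto
      moreover have "\<bar>c - (\<integral>x. f (act j x) \<partial>P)\<bar> \<le>
          \<bar>c - (\<integral>x. f (act h x) \<partial>P)\<bar> + \<bar>(\<integral>x. f (act h x) \<partial>P) - (\<integral>x. f (act j x) \<partial>P)\<bar>"
        by linarith
      moreover have "\<bar>c - (\<integral>x. f (act j x) \<partial>P)\<bar> = \<epsilon> + 2 * \<delta>"
        by (simp add: \<delta>_def field_simps)
      ultimately have "\<not> \<bar>c - (\<integral>x. f (act h x) \<partial>P)\<bar> \<le> \<epsilon>"
        using \<delta> by linarith
      then show "h \<in> space seq_space - ?D"
        using hs by simp
    qed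
    then show "\<exists>W. openin seq_top W \<and> j \<in> W \<and> W \<subseteq> space seq_space - ?D"
      using W by blast
  qed
  then show ?thesis
    unfolding closedin_def topspace_seq by auto
qed

lemma closedin_compatible: "closedin seq_top {h \<in> space seq_space. h k = \<phi> k (h (Suc k))}"
proof -
  have proj: "continuous_map seq_top (T j) (\<lambda>x. x j)" for j
    by (rule continuous_map_product_projection) simp
  have "closedin seq_top {h \<in> topspace seq_top. h k = \<phi> k (h (Suc k))}"
    using continuous_map_compose[OF proj continuous_hom, of k]
    by (intro closedin_continuous_maps_eq[of "T k"] proj
        compact_second_countable_group.Hausdorff_space[OF compact_group]) (simp add: o_def)
  then show ?thesis
    unfolding topspace_seq .
qed

text \<open>Compactness of the sequence space turns the approximate translations into an exact one. A
  fixed tolerance of 1 for all continuous functions forces equality, since multiples of a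
  continuous function are continuous.\<close>

lemma ex_translation:
  assumes P': "P' \<in> extreme_measures (solutions G T \<phi> \<mu>)"
    and P'': "P'' \<in> extreme_measures (solutions G T \<phi> \<mu>)"
  shows "\<exists>h\<in>compatible_seqs G \<phi>. \<forall>f. continuous_map seq_top euclideanreal f \<longrightarrow>
    (\<integral>x. f x \<partial>P') = (\<integral>x. f (act h x) \<partial>P'')"
proof -
  have sol: "P'' \<in> solutions G T \<phi> \<mu>"
    using P'' by (simp add: extreme_measures_def)
  define C where "C k = {h \<in> space seq_space. h k = \<phi> k (h (Suc k))}" for k
  define D where "D f = {h \<in> space seq_space. \<bar>(\<integral>x. f x \<partial>P') - (\<integral>x. f (act h x) \<partial>P'')\<bar> \<le> 1}"
    for f :: "_ \<Rightarrow> real"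
  define Fs where "Fs = {f. continuous_map seq_top euclideanreal f}"
  have "\<Inter> (range C \<union> D ` Fs) \<noteq> {}"
  proof (rule compact_space_fip[THEN iffD1, OF compact_seq, rule_format], intro conjI ballI allI impI)
    show "closedin seq_top K" if "K \<in> range C \<union> D ` Fs" for K
      using that closedin_compatible closedin_translate_close[OF _ solutionD(2,3)[OF sol]]
      by (auto simp: C_def D_def Fs_def)
    fix \<F> assume \<F>: "finite \<F> \<and> \<F> \<subseteq> range C \<union> D ` Fs"
    obtain I where I: "finite I" "\<F> \<inter> range C = C ` I"
      using finite_subset_image[of "\<F> \<inter> range C" C UNIV] \<F> by auto
    obtain F where F: "finite F" "F \<subseteq> Fs" "\<F> \<inter> D ` Fs = D ` F"
      using finite_subset_image[of "\<F> \<inter> D ` Fs" D Fs] \<F> by auto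
    obtain n where n: "\<And>k. k \<in> I \<Longrightarrow> k < n"
      using finite_nat_set_iff_bounded[of I] I(1) by auto
    have "\<exists>h\<in>space seq_space. (\<forall>k<n. h k = \<phi> k (h (Suc k))) \<and>
        (\<forall>f\<in>F. \<bar>(\<integral>x. f x \<partial>P') - (\<integral>x. f (act h x) \<partial>P'')\<bar> \<le> 1)"
      by (rule ex_approximate_translation[OF P' P'' F(1)]) (use F(2) in \<open>auto simp: Fs_def\<close>)
    then obtain h where h: "h \<in> space seq_space" "\<forall>k<n. h k = \<phi> k (h (Suc k))"
        "\<forall>f\<in>F. \<bar>(\<integral>x. f x \<partial>P') - (\<integral>x. f (act h x) \<partial>P'')\<bar> \<le> 1"
      by (elim bexE conjE) (rule that)
    have "h \<in> C k" if "k < n" for k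
      using that h(1,2) unfolding C_def by blast
    moreover have "h \<in> D f" if "f \<in> F" for f
      using that h(1,3) unfolding D_def by blast
    ultimately have hK: "h \<in> K" if "K \<in> C ` I \<union> D ` F" for K
      using that n by auto
    have "\<F> \<subseteq> C ` I \<union> D ` F"
      using \<F> I(2) F(3) by blast
    then have "h \<in> \<Inter>\<F>"
      by (intro InterI hK) auto
    then show "\<Inter>\<F> \<noteq> {}"
      by auto
  qed
  then obtain h where hC: "\<And>k. h \<in> C k" and hD: "\<And>f. f \<in> Fs \<Longrightarrow> h \<in> D f"
    by auto
  have "(\<integral>x. f x \<partial>P') = (\<integral>x. f (act h x) \<partial>P'')" if f: "continuous_map seq_top euclideanreal f" for f
  proof (rule ccontr)
    define d where "d = (\<integral>x. f x \<partial>P') - (\<integral>x. f (act h x) \<partial>P'')"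
    assume "(\<integral>x. f x \<partial>P') \<noteq> (\<integral>x. f (act h x) \<partial>P'')"
    then have "d \<noteq> 0" by (simp add: d_def)
    have "(\<lambda>x. (2 / d) * f x) \<in> Fs"
      unfolding Fs_def mem_Collect_eq by (rule continuous_map_real_mult_left[OF f])
    from hD[OF this] have "\<bar>(2 / d) * (\<integral>x. f x \<partial>P') - (2 / d) * (\<integral>x. f (act h x) \<partial>P'')\<bar> \<le> 1"
      by (simp add: D_def)
    then have "\<bar>(2 / d) * d\<bar> \<le> 1"
      unfolding d_def right_diff_distrib .
    then show False
      using \<open>d \<noteq> 0\<close> by simp
  qed
  moreover have "h \<in> compatible_seqs G \<phi>"
    using hC unfolding compatible_seqs_def C_def space_seq by blast
  ultimately show ?thesis by blast
qed

theorem extreme_solutions_translate: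
  assumes P': "P' \<in> extreme_measures (solutions G T \<phi> \<mu>)"
    and P'': "P'' \<in> extreme_measures (solutions G T \<phi> \<mu>)"
  shows "\<exists>h\<in>compatible_seqs G \<phi>. P' = translate G T h P''"
proof -
  have sol: "P' \<in> solutions G T \<phi> \<mu>" "P'' \<in> solutions G T \<phi> \<mu>"
    using P' P'' by (simp_all add: extreme_measures_def)
  obtain h where h: "h \<in> compatible_seqs G \<phi>"
      "\<And>f. continuous_map seq_top euclideanreal f \<Longrightarrow> (\<integral>x. f x \<partial>P') = (\<integral>x. f (act h x) \<partial>P'')"
    using ex_translation[OF P' P''] by blast
  have hs: "h \<in> space seq_space"
    using h(1) unfolding compatible_seqs_def space_seq by blast
  have translate: "translate G T h P'' = distr P'' (borel_of seq_top) (act h)"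
    by (simp add: translate_def act_def[abs_def])
  have meas: "act h \<in> P'' \<rightarrow>\<^sub>M borel_of seq_top"
    using continuous_map_measurable[OF continuous_act_right[OF hs]]
    by (simp add: solutionD(3)[OF sol(2)] sets_seq cong: measurable_cong_sets)
  have "P' = translate G T h P''"
  proof (rule borel_prob_eqI_continuous[OF compact_seq Hausdorff_seq])
    show "second_countable seq_top"
      by (rule second_countable_seq_topology) (rule second_countable)
    show "P' \<in> borel_prob seq_top"
      by (rule solutionD(1)[OF sol(1)])
    show "translate G T h P'' \<in> borel_prob seq_top"
      unfolding translate borel_prob_def
      using prob_space.prob_space_distr[OF solutionD(2)[OF sol(2)] meas] by simp
    fix f assume f: "continuous_map seq_top euclideanreal f"
    have "f \<in> borel_measurable (borel_of seq_top)"
      by (rule continuous_map_borel_measurable[OF f])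
    then show "(\<integral>x. f x \<partial>P') = (\<integral>x. f x \<partial>translate G T h P'')"
      unfolding translate h(2)[OF f] using meas by (simp add: integral_distr)
  qed
  then show ?thesis
    using h(1) by blast
qed

end

theorem theorem2p11:
  fixes G :: "nat \<Rightarrow> ('a, 'b) monoid_scheme"
    and T :: "nat \<Rightarrow> 'a topology"
    and \<phi> :: "nat \<Rightarrow> 'a \<Rightarrow> 'a"
    and \<mu> :: "nat \<Rightarrow> 'a measure"
  assumes "\<And>k. compact_second_countable_group (G k) (T k)"
    and "\<And>k. \<phi> k \<in> hom (G (Suc k)) (G k)"
    and "\<And>k. continuous_map (T (Suc k)) (T k) (\<phi> k)"
    and "\<And>k. \<mu> k \<in> borel_prob (T k)"
  shows "\<forall>P' \<in> extreme_measures (solutions G T \<phi> \<mu>). \<forall>P'' \<in> extreme_measures (solutions G T \<phi> \<mu>).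
           \<exists>h \<in> compatible_seqs G \<phi>. P' = translate G T h P''"
proof (intro ballI)
  interpret stochastic_equation G T \<phi> \<mu>
    using assms by (rule stochastic_equation.intro)
  fix P' P''
  assume "P' \<in> extreme_measures (solutions G T \<phi> \<mu>)" "P'' \<in> extreme_measures (solutions G T \<phi> \<mu>)"
  then show "\<exists>h\<in>compatible_seqs G \<phi>. P' = translate G T h P''"
    by (rule extreme_solutions_translate)
qed

end
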